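(* Let $\alpha \in \mathbb{Q} \cap (0,2]$, $\rho \in [1-1/\alpha,\,1/\alpha]\cap(0,1)$ and $\beta \in (0,1)$. Then $$ \begin{aligned} g'(\beta) ={}& \sum_{m\ge 1,\ \frac{m}{\alpha}\notin\mathbb{N}} \frac{(-1)^{m+1} \beta^{m-1}\sin(\rho m\pi)}{\sin\left(\frac{m\pi}{\alpha}\right)} + \alpha\sum_{k\ge 1,\ \alpha k\notin\mathbb{N}} \frac{(-1)^{k+1} \beta^{\alpha k-1}\sin(\rho\alpha k \pi)}{\sin(\alpha k\pi)} \\ & + \frac{\alpha\log(\beta)}{\pi}\sum_{m\ge 1,\ \frac{m}{\alpha}\in\mathbb{N}} (-1)^{m+\frac{m}{\alpha}} \beta^{m-1}\sin(\rho m\pi) + \alpha\rho \sum_{k\ge 1,\ \alpha k\in\mathbb{N}} (-1)^{k(\alpha+1)}\beta^{\alpha k-1} \cos(\alpha\rho k\pi)\,, \end{aligned} $$ where $m$ and $k$ range over positive integers.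
   Context: $\mathbb{N}=\{1,2,3,\dots\}$. For given $\alpha$ and $\rho$, the function $g$ is defined for $\beta>0$ by $$ g(\beta) = \frac{\sin(\pi \rho)}{\pi}\int_0^\infty \frac{\beta \log(1 + x^\alpha)}{x^2+2x\beta\cos(\pi\rho)+\beta^2}\,dx , $$ and $g'$ denotes its derivative in $\beta$.
   Formalization: The third and fourth series (over m/α ∈ ℕ and over αk ∈ ℕ) enter with a minus sign instead of the printed plus; with plus the formula fails, e.g. α=2, ρ=1/2, where g(β)=log(1+β) but the printed right side is 1/(1−β). *)

theory Defs
  imports "HOL-Analysis.Analysis"
begin

definition g :: "real \<Rightarrow> real \<Rightarrow> real \<Rightarrow> real" where
  "g \<alpha> \<rho> \<beta> = sin (pi * \<rho>) / pi *
     (LINT x:{0<..}|lborel.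
        \<beta> * ln (1 + x powr \<alpha>) / (x\<^sup>2 + 2 * x * \<beta> * cos (pi * \<rho>) + \<beta>\<^sup>2))"

(* Conventions for the series expansion of the derivative of g:
   - m and k range over positive integers.  Since m / \<alpha> and \<alpha> * k are positive, membership
     in \<nat> (which contains 0) means being a positive integer.
   - The exponents m + m / \<alpha> and k * (\<alpha> + 1) occur only when they are positive integers,
     so nat \<lfloor>_\<rfloor> merely changes their type.
   - The two series over the indices with m / \<alpha> \<in> \<nat> and \<alpha> * k \<in> \<nat> enter with a minus sign,
     contrary to the plus signs in the source, which are a misprint: with plus signs the
     formula fails, e.g. for \<alpha> = 2, \<rho> = 1/2, where g \<alpha> \<rho> \<beta> = ln (1 + \<beta>) and it would give
     1 / (1 - \<beta>) instead of 1 / (1 + \<beta>). *)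

end

theory Submission
  imports Defs "HOL-Real_Asymp.Real_Asymp"
begin

text \<open>
Put \<open>\<theta> = \<pi>\<rho>\<close> and \<open>\<phi>(t) = t\<^sup>\<alpha> / (1 + t\<^sup>\<alpha>)\<close>. Substituting \<open>x = \<beta>y\<close> for \<open>x < \<beta>\<close> and \<open>x = \<beta>/y\<close> for
\<open>x > \<beta>\<close> folds the integral defining \<open>g\<close> onto \<open>[0,1]\<close>, and differentiation in \<open>\<beta>\<close> gives
\<open>g'(\<beta>) = \<alpha>/(\<pi>\<beta>) \<integral> K(y) (\<phi>(\<beta>y) + \<phi>(\<beta>/y)) dy\<close> over \<open>[0,1]\<close> (\<open>g_has_derivative\<close>), where
\<open>K(y) = sin \<theta> / (y\<^sup>2 + 2y cos \<theta> + 1)\<close> is the sum of \<open>(-1)\<^sup>n\<^sup>+\<^sup>1 sin(n\<theta>) y\<^sup>n\<^sup>-\<^sup>1\<close> over \<open>n \<ge> 1\<close>.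

The remainders of this kernel series are at most \<open>y\<^sup>N / cos(\<theta>/2)\<close>, so it may be integrated term by
term up to \<open>y = 1\<close>, and the integral becomes \<open>\<Sum>n. (-1)\<^sup>n\<^sup>+\<^sup>1 sin(n\<theta>) J(n)\<close> with the moments
\<open>J(n) = \<integral> y\<^sup>n\<^sup>-\<^sup>1 (\<phi>(\<beta>y) + \<phi>(\<beta>/y)) dy\<close>. Expanding \<open>\<phi>\<close> into alternating geometric series in powers of
its argument writes \<open>J(n)\<close> as \<open>\<beta>\<^sup>n\<close> times a coefficient plus a series in the powers \<open>\<beta>\<^sup>\<alpha>\<^sup>k\<close>
(\<open>moment_expansion\<close>). The coefficient is \<open>\<pi> / (\<alpha> sin(n\<pi>/\<alpha>))\<close> by the partial fraction expansion of the
cosecant. If some \<open>\<alpha>k\<close> equals \<open>n\<close>, the integral of \<open>1/y\<close> replaces it by a logarithm.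
These coefficients yield the two sums over \<open>m\<close>.

Summing the remaining double series over \<open>n\<close> first, the coefficient of \<open>\<beta>\<^sup>s\<close> with \<open>s = \<alpha>k\<close> is up to sign the
Fourier sine series of \<open>\<pi> sin(s\<theta>) / sin(s\<pi>)\<close>, or its resonant analogue \<open>(-1)\<^sup>s \<theta> cos(s\<theta>)\<close> for integral \<open>s\<close>
(\<open>sine_expansion\<close>); this yields the two sums over \<open>k\<close>. The double series converges only
conditionally. Subtracting \<open>2\<phi>(\<beta>)/n\<close> from each \<open>J(n)\<close>, which by the sawtooth series removes the amount
\<open>\<theta>\<phi>(\<beta>)\<close>, makes it absolutely convergent: \<open>\<alpha>\<close> is rational, hence \<open>\<bar>n - \<alpha>k\<bar>\<close> is bounded below
whenever it does not vanish (\<open>poisson_integral_folded_profile\<close>).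

The cosecant expansion and the sine series come from one source. The function
\<open>F(x) = \<Sum>m. (-1)\<^sup>m cos(mx) / (m\<^sup>2(m\<^sup>2 - a\<^sup>2))\<close> has the property that on \<open>[0,\<pi>]\<close> \<open>F'' + a\<^sup>2F\<close> is a quadratic
polynomial plus, for integral \<open>a\<close>, a multiple of \<open>cos(ax)\<close>. This differential equation is solved
explicitly (\<open>pole_sine_series\<close>).

Throughout, \<open>1/0 = 0\<close> deletes the singular terms of such series, so that the resonant and the
non-resonant case are mostly treated by the same formulas.
\<close>

section \<open>The Poisson-type kernel\<close>

definition poisson_kernel :: "real \<Rightarrow> real \<Rightarrow> real" where
  "poisson_kernel x y = sin x / (y\<^sup>2 + 2 * y * cos x + 1)"

text \<open>Rotating \<open>1 + y e\<^sup>i\<^sup>x\<close> by the angle \<open>-x/2\<close> makes its real part \<open>(1 + y) cos(x/2)\<close>.\<close>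

lemma norm_one_plus_cis_ge:
  assumes "0 \<le> y" "-pi < x" "x < pi"
  shows "cos (x/2) \<le> norm (1 + of_real y * cis x)"
proof -
  have c: "0 < cos (x/2)" using assms by (intro cos_gt_zero_pi) auto
  have "cos (x/2) \<le> (1+y) * cos (x/2)" using c assms by (simp add: algebra_simps)
  also have "\<dots> = Re (cis (-x/2) * (1 + of_real y * cis x))"
  proof -
    have "cis (-x/2) * cis x = cis (x/2)" by (simp only: cis_mult) (simp add: field_simps)
    then have e: "cis (-x/2) * (1 + of_real y * cis x) = cis (-x/2) + of_real y * cis (x/2)"
      by (simp add: distrib_left mult.left_commute)
    show ?thesis unfolding e by (simp add: distrib_right)
  qed
  also have "\<dots> \<le> norm (cis (-x/2) * (1 + of_real y * cis x))" by (rule complex_Re_le_cmod)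
  also have "\<dots> = norm (1 + of_real y * cis x)" by (simp add: norm_mult)
  finally show ?thesis .
qed

lemma norm_one_plus_cis_sq:
  "(norm (1 + of_real y * cis x))\<^sup>2 = y\<^sup>2 + 2 * y * cos x + 1"
proof -
  have "(norm (1 + of_real y * cis x))\<^sup>2 = (1 + y * cos x)\<^sup>2 + (y * sin x)\<^sup>2" by (simp add: cmod_power2)
  also have "\<dots> = y\<^sup>2 * ((sin x)\<^sup>2 + (cos x)\<^sup>2) + 2 * y * cos x + 1"
    unfolding power2_eq_square distrib_left distrib_right by (simp add: mult_ac)
  finally show ?thesis by simp
qed

lemma poisson_denominator_pos:
  assumes "0 \<le> y" "-pi < x" "x < pi"
  shows "0 < y\<^sup>2 + 2 * y * cos x + 1"
proof -
  have "0 < cos (x/2)" using assms by (intro cos_gt_zero_pi) auto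
  then have "0 < (norm (1 + of_real y * cis x))\<^sup>2" using norm_one_plus_cis_ge[OF assms] by auto
  also note norm_one_plus_cis_sq
  finally show ?thesis .
qed

text \<open>The sum is the imaginary part of a geometric series with ratio \<open>-y e\<^sup>i\<^sup>x\<close>. The bound stays finite at
\<open>y = 1\<close>, where the series itself does not converge in general; this is what permits termwise integration over \<open>[0,1]\<close>.\<close>

lemma poisson_kernel_partial_sum:
  assumes "0 \<le> y" "-pi < x" "x < pi"
  shows "\<bar>(\<Sum>m<N. (-1)^m * sin (real (Suc m) * x) * y^m) - poisson_kernel x y\<bar> \<le> y^N / cos (x/2)"
proof -
  define w where "w = cis x"
  define z where "z = - of_real y * w"
  have c: "0 < cos (x/2)" using assms by (intro cos_gt_zero_pi) auto
  have n1: "cos (x/2) \<le> norm (1 - z)" using norm_one_plus_cis_ge[OF assms] by (simp add: z_def w_def)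
  then have z1: "1 - z \<noteq> 0" using c by auto
  have d: "(norm (1 - z))\<^sup>2 = y\<^sup>2 + 2 * y * cos x + 1"
    using norm_one_plus_cis_sq[of y x] by (simp add: z_def w_def)
  have "w / (1 - z) = w * cnj (1 - z) / of_real ((norm (1 - z))\<^sup>2)"
    by (subst complex_div_cnj) (simp add: power2_eq_square)
  moreover have "w * cnj (1 - z) = w + of_real y"
  proof -
    have "w * cnj w = 1" by (simp add: w_def cis_cnj cis_mult)
    then show ?thesis by (simp add: z_def algebra_simps)
  qed
  ultimately have K: "poisson_kernel x y = Im (w / (1 - z))"
    by (simp add: d poisson_kernel_def w_def Im_divide_of_real del: of_real_add of_real_power)
  have T: "(-1)^m * sin (real (Suc m) * x) * y^m = Im (w * z^m)" for m
  proof -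
    have "w * z^m = of_real ((-1)^m * y^m) * (w * w^m)"
      by (simp add: z_def power_mult_distrib power_minus[of "of_real y * w"])
    also have "w * w^m = cis (real (Suc m) * x)" unfolding w_def using Complex.DeMoivre[of x "Suc m"] by (simp only: power_Suc)
    finally show ?thesis by (simp del: of_real_mult of_real_power of_nat_Suc)
  qed
  have "(\<Sum>m<N. (-1)^m * sin (real (Suc m) * x) * y^m) = Im (\<Sum>m<N. w * z^m)"
    by (simp only: T Im_sum)
  also have "(\<Sum>m<N. w * z^m) = w / (1 - z) - w * z^N / (1 - z)"
    using z1 by (simp add: sum_distrib_left[symmetric] sum_gp_strict diff_divide_distrib[symmetric] algebra_simps)
  finally have "(\<Sum>m<N. (-1)^m * sin (real (Suc m) * x) * y^m) - poisson_kernel x y = - Im (w * z^N / (1 - z))"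
    by (simp add: K)
  then have "\<bar>(\<Sum>m<N. (-1)^m * sin (real (Suc m) * x) * y^m) - poisson_kernel x y\<bar> \<le> norm (w * z^N / (1 - z))"
    using abs_Im_le_cmod[of "w * z^N / (1 - z)"] by simp
  also have "\<dots> = y^N / norm (1 - z)" using assms by (simp add: norm_mult norm_divide norm_power z_def w_def)
  also have "\<dots> \<le> y^N / cos (x/2)" 
    using n1 c assms order_less_le_trans[OF c n1] by (intro divide_left_mono mult_pos_pos) auto
  finally show ?thesis .
qed

lemma continuous_on_poisson_kernel:
  assumes "-pi < x" "x < pi"
  shows "continuous_on {0..1} (poisson_kernel x)"
  unfolding poisson_kernel_def
  using poisson_denominator_pos[OF _ assms] by (intro continuous_intros) force

lemma has_integral_power_unit: "((\<lambda>y::real. y^m) has_integral (1 / real (Suc m))) {0..1}"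
proof -
  have "((\<lambda>y::real. y^m) has_integral (1^Suc m / real (Suc m) - 0^Suc m / real (Suc m))) {0..1}"
  proof (rule fundamental_theorem_of_calculus)
    fix y :: real assume "y \<in> {0..1}"
    have "((\<lambda>y. y^Suc m / real (Suc m)) has_real_derivative (real (Suc m) * y^m / real (Suc m))) (at y within {0..1})"
      using DERIV_cdivide[OF DERIV_pow[of "Suc m" y "{0..1}"], of "real (Suc m)"] by simp
    then show "((\<lambda>y. y^Suc m / real (Suc m)) has_vector_derivative y^m) (at y within {0..1})"
      by (simp add: has_real_derivative_iff_has_vector_derivative del: of_nat_Suc power_Suc)
  qed simp
  then show ?thesis by simp
qed

text \<open>The explicit rate, uniform for \<open>x\<close> in compact subsets of \<open>(-\<pi>,\<pi>)\<close>, is what the termwise integration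
in \<open>alternating_cosine_squares\<close> relies on.\<close>

lemma poisson_integral_partial_sum:
  assumes x: "-pi < x" "x < pi" and cont: "continuous_on {0..1} \<psi>"
    and M: "\<And>y. 0 \<le> y \<Longrightarrow> y \<le> 1 \<Longrightarrow> \<bar>\<psi> y\<bar> \<le> M"
  shows "\<bar>(\<Sum>m<N. (-1)^m * sin (real (Suc m) * x) * integral {0..1} (\<lambda>y. y^m * \<psi> y))
     - integral {0..1} (\<lambda>y. poisson_kernel x y * \<psi> y)\<bar> \<le> M / (real (Suc N) * cos (x/2))"
proof -
  have c: "0 < cos (x/2)" using x by (intro cos_gt_zero_pi) auto
  let ?P = "\<lambda>y. (\<Sum>m<N. (-1)^m * sin (real (Suc m) * x) * y^m)"
  have eq: "(\<Sum>m<N. (-1)^m * sin (real (Suc m) * x) * integral {0..1} (\<lambda>y. y^m * \<psi> y))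
      = integral {0..1} (\<lambda>y. ?P y * \<psi> y)"
  proof -
    have "integral {0..1} (\<lambda>y. ?P y * \<psi> y) 
        = integral {0..1} (\<lambda>y. \<Sum>m<N. (-1)^m * sin (real (Suc m) * x) * (y^m * \<psi> y))"
      by (simp only: sum_distrib_right mult.assoc)
    also have "\<dots> = (\<Sum>m<N. integral {0..1} (\<lambda>y. (-1)^m * sin (real (Suc m) * x) * (y^m * \<psi> y)))"
      by (intro integral_sum integrable_continuous_real continuous_intros cont) auto
    finally show ?thesis by simp
  qed
  have i1: "(\<lambda>y. ?P y * \<psi> y) integrable_on {0..1}"
    by (intro integrable_continuous_real continuous_intros cont)
  have i2: "(\<lambda>y. poisson_kernel x y * \<psi> y) integrable_on {0..1}"
    by (intro integrable_continuous_real continuous_intros cont continuous_on_poisson_kernel x)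
  have hp: "((\<lambda>y::real. y^N * (M / cos (x/2))) has_integral (1 / real (Suc N)) * (M / cos (x/2))) {0..1}"
    by (intro has_integral_mult_left has_integral_power_unit)
  have "norm (integral {0..1} (\<lambda>y. (?P y - poisson_kernel x y) * \<psi> y)) \<le> integral {0..1} (\<lambda>y. y^N * (M / cos (x/2)))"
  proof (rule integral_norm_bound_integral)
    show "(\<lambda>y. (?P y - poisson_kernel x y) * \<psi> y) integrable_on {0..1}"
      using integrable_diff[OF i1 i2] by (simp add: algebra_simps)
    show "(\<lambda>y::real. y^N * (M / cos (x/2))) integrable_on {0..1}" using hp by blast
    fix y :: real assume y: "y \<in> {0..1}"
    have "\<bar>?P y - poisson_kernel x y\<bar> * \<bar>\<psi> y\<bar> \<le> (y^N / cos (x/2)) * M"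
      using poisson_kernel_partial_sum[of y x N] M[of y] y x c by (intro mult_mono) auto
    then show "norm ((?P y - poisson_kernel x y) * \<psi> y) \<le> y^N * (M / cos (x/2))" by (simp add: abs_mult)
  qed
  also have "\<dots> = M / (real (Suc N) * cos (x/2))" using integral_unique[OF hp] by simp
  also have "integral {0..1} (\<lambda>y. (?P y - poisson_kernel x y) * \<psi> y) 
     = integral {0..1} (\<lambda>y. ?P y * \<psi> y) - integral {0..1} (\<lambda>y. poisson_kernel x y * \<psi> y)"
    using integral_diff[OF i1 i2] by (simp add: algebra_simps)
  finally show ?thesis unfolding eq by simp
qed

lemma poisson_integral_sums:
  assumes x: "-pi < x" "x < pi" and cont: "continuous_on {0..1} \<psi>"
  shows "(\<lambda>m. (-1)^m * sin (real (Suc m) * x) * integral {0..1} (\<lambda>y. y^m * \<psi> y))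
    sums integral {0..1} (\<lambda>y. poisson_kernel x y * \<psi> y)"
proof -
  have "bounded (\<psi> ` {0..1})" using compact_continuous_image[OF cont] compact_imp_bounded by blast
  then obtain M where M: "\<And>y. 0 \<le> y \<Longrightarrow> y \<le> 1 \<Longrightarrow> \<bar>\<psi> y\<bar> \<le> M" 
    unfolding bounded_iff by (metis atLeastAtMost_iff imageI real_norm_def)
  have "(\<lambda>N. M / (real (Suc N) * cos (x/2))) \<longlonglongrightarrow> 0"
    using tendsto_mult_right_zero[OF LIMSEQ_inverse_real_of_nat, of "M / cos (x/2)"] by (simp add: field_simps)
  then have "(\<lambda>N. (\<Sum>m<N. (-1)^m * sin (real (Suc m) * x) * integral {0..1} (\<lambda>y. y^m * \<psi> y))
     - integral {0..1} (\<lambda>y. poisson_kernel x y * \<psi> y)) \<longlonglongrightarrow> 0"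
    by (rule Lim_null_comparison[rotated])
      (use poisson_integral_partial_sum[OF x cont M] in \<open>auto intro!: always_eventually\<close>)
  then show ?thesis unfolding sums_def using LIM_zero_iff by blast
qed

text \<open>An antiderivative is \<open>arctan((y + cos x) / sin x)\<close>; its values at \<open>0\<close> and \<open>1\<close> are \<open>\<pi>/2 - x\<close> and
\<open>\<pi>/2 - x/2\<close>, because the arguments there are \<open>cot x\<close> and \<open>cot(x/2)\<close>.\<close>

lemma integral_poisson_kernel:
  assumes x: "0 < x" "x < pi"
  shows "integral {0..1} (poisson_kernel x) = x/2"
proof -
  have s: "0 < sin x" using x by (rule sin_gt_zero)
  have "(poisson_kernel x has_integral (arctan ((1 + cos x)/sin x) - arctan ((0 + cos x)/sin x))) {0..1}"
  proof (rule fundamental_theorem_of_calculus)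
    fix y :: real assume y: "y \<in> {0..1}"
    have p: "0 < y\<^sup>2 + 2 * y * cos x + 1" using y x by (intro poisson_denominator_pos) auto
    have e: "(sin x)\<^sup>2 + (y + cos x)\<^sup>2 = y\<^sup>2 + 2 * y * cos x + 1"
      using sin_cos_squared_add[of x] by (simp add: power2_eq_square algebra_simps)
    have "inverse (1 + ((y + cos x)/sin x)\<^sup>2) * (1 / sin x) = poisson_kernel x y"
    proof -
      have "1 + ((y + cos x)/sin x)\<^sup>2 = (y\<^sup>2 + 2 * y * cos x + 1) / (sin x)\<^sup>2"
        using s e by (simp add: power_divide field_simps)
      then show ?thesis using s p by (simp add: poisson_kernel_def power2_eq_square)
    qed
    moreover have "((\<lambda>y. arctan ((y + cos x)/sin x)) has_real_derivative inverse (1 + ((y + cos x)/sin x)\<^sup>2) * (1 / sin x)) (at y within {0..1})"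
      using s by (auto intro!: derivative_eq_intros)
    ultimately show "((\<lambda>y. arctan ((y + cos x)/sin x)) has_vector_derivative poisson_kernel x y) (at y within {0..1})"
      by (simp add: has_real_derivative_iff_has_vector_derivative)
  qed simp
  moreover have "arctan ((0 + cos x)/sin x) = pi/2 - x"
  proof -
    have "(0 + cos x)/sin x = tan (pi/2 - x)" by (simp add: tan_def sin_diff cos_diff)
    then show ?thesis using x arctan_tan[of "pi/2 - x"] by simp
  qed
  moreover have "arctan ((1 + cos x)/sin x) = pi/2 - x/2"
  proof -
    have h: "0 < cos (x/2)" "0 < sin (x/2)" using x by (auto intro!: cos_gt_zero sin_gt_zero)
    have "1 + cos x = 2 * cos (x/2) * cos (x/2)" using cos_double_cos[of "x/2"] by (simp add: power2_eq_square)
    moreover have "sin x = 2 * sin (x/2) * cos (x/2)" using sin_double[of "x/2"] by simp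
    ultimately have "(1 + cos x)/sin x = cos (x/2)/sin (x/2)" using h by simp
    also have "\<dots> = tan (pi/2 - x/2)" by (simp add: tan_def sin_diff cos_diff)
    finally show ?thesis using x arctan_tan[of "pi/2 - x/2"] by simp
  qed
  ultimately show ?thesis by (simp add: integral_unique)
qed

lemma sawtooth_partial_sum:
  assumes x: "0 \<le> x" "x < pi"
  shows "\<bar>(\<Sum>m<N. (-1)^m * sin (real (Suc m) * x) / real (Suc m)) - x/2\<bar> \<le> 1 / (real (Suc N) * cos (x/2))"
proof (cases "x = 0")
  case False
  have p: "integral {0..1} (\<lambda>y::real. y^m * 1) = 1 / real (Suc m)" for m
    using has_integral_power_unit[of m] by (simp add: integral_unique)
  have "integral {0..1} (\<lambda>y. poisson_kernel x y * 1) = x/2" using integral_poisson_kernel[of x] x False by simp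
  then show ?thesis
    using poisson_integral_partial_sum[of x "\<lambda>y. 1" 1 N, unfolded p] x False by simp
qed auto

lemma sawtooth_sums:
  assumes "0 < x" "x < pi"
  shows "(\<lambda>m. (-1)^m * sin (real (Suc m) * x) * (1 / real (Suc m))) sums (x/2)"
proof -
  have "integral {0..1} (\<lambda>y::real. y^m * 1) = 1 / real (Suc m)" for m
    using has_integral_power_unit[of m] by (simp add: integral_unique)
  then show ?thesis using poisson_integral_sums[of x "\<lambda>_. 1"] integral_poisson_kernel[of x] assms by simp
qed

section \<open>The derivative as an integral over the unit interval\<close>

text \<open>The sum \<open>\<phi>(\<beta>y) + \<phi>(\<beta>/y)\<close> for \<open>\<phi>(t) = t\<^sup>\<alpha> / (1 + t\<^sup>\<alpha>)\<close>. The second summand is cleared of \<open>\<beta>/y\<close>, which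
makes the function continuous at \<open>y = 0\<close>.\<close>

definition folded_profile :: "real \<Rightarrow> real \<Rightarrow> real \<Rightarrow> real" where
  "folded_profile \<alpha> \<beta> y =
    (\<beta> * y) powr \<alpha> / (1 + (\<beta> * y) powr \<alpha>) + \<beta> powr \<alpha> / (y powr \<alpha> + \<beta> powr \<alpha>)"

lemma continuous_on_folded_profile:
  assumes "0 < \<alpha>" "0 < \<beta>"
  shows "continuous_on {0..1} (folded_profile \<alpha> \<beta>)"
  unfolding folded_profile_def using assms
  by (intro continuous_intros continuous_on_powr') (auto simp: add_nonneg_eq_0_iff)

text \<open>The kernel is bounded, and \<open>\<bar>ln y\<bar> \<le> 2 / sqrt y\<close> on \<open>(0,1)\<close>.\<close>

lemma poisson_kernel_ln_absolutely_integrable: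
  assumes \<theta>: "0 < \<theta>" "\<theta> < pi"
  shows "(\<lambda>y. poisson_kernel \<theta> y * ln y) absolutely_integrable_on {0<..<1}"
proof -
  have "bounded (poisson_kernel \<theta> ` {0..1})"
    using \<theta> by (intro compact_imp_bounded compact_continuous_image continuous_on_poisson_kernel) auto
  then obtain C where C: "\<And>y. 0 \<le> y \<Longrightarrow> y \<le> 1 \<Longrightarrow> \<bar>poisson_kernel \<theta> y\<bar> \<le> C"
    unfolding bounded_iff by (metis atLeastAtMost_iff imageI real_norm_def)
  show ?thesis
  proof (rule measurable_bounded_by_integrable_imp_absolutely_integrable)
    have "continuous_on {0<..<1} (\<lambda>y. poisson_kernel \<theta> y * ln y)"
      using \<theta> by (intro continuous_intros continuous_on_subset[OF continuous_on_poisson_kernel]) auto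
    then show "(\<lambda>y. poisson_kernel \<theta> y * ln y) \<in> borel_measurable (lebesgue_on {0<..<1})"
      by (intro continuous_imp_measurable_on_sets_lebesgue) auto
    have "((\<lambda>y. C * (2 * y powr (-1/2))) has_integral (C * (2 * (1 powr (-1/2 + 1) / (-1/2 + 1))))) {0..1}"
      by (intro has_integral_mult_right has_integral_powr_from_0) auto
    then show "(\<lambda>y. C * (2 * y powr (-1/2))) integrable_on {0<..<1}"
      by (metis has_integral_integrable integrable_on_Icc_iff_Ioo)
    fix y :: real assume y: "y \<in> {0<..<1}"
    have "ln (y powr (-1/2)) \<le> y powr (-1/2) - 1" using y by (intro ln_le_minus_one) auto
    then have "\<bar>ln y\<bar> \<le> 2 * y powr (-1/2)" using y by (simp add: ln_powr abs_if)
    then show "norm (poisson_kernel \<theta> y * ln y) \<le> C * (2 * y powr (-1/2))"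
      unfolding norm_mult using C[of y] y by (intro mult_mono) auto
  qed auto
qed

text \<open>The substitutions \<open>x = by\<close> and \<open>x = b/y\<close> turn the integrals over \<open>(0,b)\<close> and \<open>(b,\<infinity>)\<close> into integrals over
\<open>(0,1)\<close> against the same kernel. Writing \<open>ln(1 + (b/y)\<^sup>\<alpha>) = ln(y\<^sup>\<alpha> + b\<^sup>\<alpha>) - \<alpha> ln y\<close> moves the
singularity at \<open>y = 0\<close> into a term that does not depend on \<open>b\<close>.\<close>

lemma g_eq_folded:
  assumes \<alpha>: "0 < \<alpha>" and \<rho>: "0 < \<rho>" "\<rho> < 1" and b: "0 < b"
  shows "g \<alpha> \<rho> b = (integral {0..1} (\<lambda>y. poisson_kernel (pi * \<rho>) y * (ln (1 + (b * y) powr \<alpha>) + ln (y powr \<alpha> + b powr \<alpha>)))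
      - \<alpha> * integral {0..1} (\<lambda>y. poisson_kernel (pi * \<rho>) y * ln y)) / pi"
proof -
  define \<theta> where "\<theta> = pi * \<rho>"
  have \<theta>: "0 < \<theta>" "\<theta> < pi" using \<rho> by (auto simp: \<theta>_def)
  let ?K = "poisson_kernel \<theta>"
  define F where "F = (\<lambda>x. sin \<theta> * (b * ln (1 + x powr \<alpha>) / (x\<^sup>2 + 2 * x * b * cos \<theta> + b\<^sup>2)))"
  let ?L1 = "\<lambda>y. ?K y * ln (1 + (b * y) powr \<alpha>)"
  let ?L2 = "\<lambda>y. ?K y * ln (y powr \<alpha> + b powr \<alpha>)"
  let ?L3 = "\<lambda>y. ?K y * ln y"
  have F1: "\<bar>b\<bar> * F (b * y) = ?L1 y" for y
  proof -
    have "(b * y)\<^sup>2 + 2 * (b * y) * b * cos \<theta> + b\<^sup>2 = b\<^sup>2 * (y\<^sup>2 + 2 * y * cos \<theta> + 1)"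
      by (simp add: power2_eq_square algebra_simps)
    then show ?thesis using b by (simp add: F_def poisson_kernel_def power2_eq_square)
  qed
  have F2: "\<bar>- b / y\<^sup>2\<bar> * F (b / y) = ?L2 y - \<alpha> * ?L3 y" if y: "y \<in> {0<..<1}" for y
  proof -
    have "(b / y)\<^sup>2 + 2 * (b / y) * b * cos \<theta> + b\<^sup>2 = (b\<^sup>2 / y\<^sup>2) * (y\<^sup>2 + 2 * y * cos \<theta> + 1)"
      using y by (simp add: field_simps power2_eq_square)
    then have "\<bar>- b / y\<^sup>2\<bar> * F (b / y) = ?K y * ln (1 + (b / y) powr \<alpha>)"
      using b y by (simp add: F_def poisson_kernel_def power2_eq_square)
    also have "1 + (b / y) powr \<alpha> = (y powr \<alpha> + b powr \<alpha>) / y powr \<alpha>"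
      using y by (simp add: powr_divide add_divide_distrib)
    also have "ln \<dots> = ln (y powr \<alpha> + b powr \<alpha>) - \<alpha> * ln y"
    proof -
      have "0 < y powr \<alpha>" "0 < y powr \<alpha> + b powr \<alpha>" using y b by (auto intro: add_pos_pos)
      then show ?thesis using y by (simp add: ln_div ln_powr)
    qed
    finally show ?thesis by (simp add: algebra_simps)
  qed
  have c1: "continuous_on {0..1} ?L1" and c2: "continuous_on {0..1} ?L2"
    using \<alpha> b \<theta> by (auto intro!: continuous_intros continuous_on_powr' continuous_on_poisson_kernel simp: add_nonneg_eq_0_iff)
  have a1: "?L1 absolutely_integrable_on {0<..<1}" and a2: "?L2 absolutely_integrable_on {0<..<1}"
    using absolutely_integrable_continuous_real[OF c1] absolutely_integrable_continuous_real[OF c2]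
    by (auto intro: set_integrable_subset)
  have a3: "(\<lambda>y. ?L2 y - \<alpha> * ?L3 y) absolutely_integrable_on {0<..<1}"
    by (intro set_integral_diff a2 set_integrable_mult_right poisson_kernel_ln_absolutely_integrable \<theta>)
  have i1: "integral {0<..<1} ?L1 = integral {0..1} ?L1" by (rule integral_open_interval_real[symmetric])
  have i2: "integral {0<..<1} (\<lambda>y. ?L2 y - \<alpha> * ?L3 y) = integral {0..1} ?L2 - \<alpha> * integral {0..1} ?L3"
  proof -
    have L: "?L2 integrable_on {0<..<1}" "?L3 integrable_on {0<..<1}"
      using set_lebesgue_integral_eq_integral(1)[OF a2]
        set_lebesgue_integral_eq_integral(1)[OF poisson_kernel_ln_absolutely_integrable[OF \<theta>]] by auto
    have "(\<lambda>y. \<alpha> * ?L3 y) integrable_on {0<..<1}" using integrable_on_cmult_left[OF L(2), of \<alpha>] by simp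
    from integral_diff[OF L(1) this]
    have "integral {0<..<1} (\<lambda>y. ?L2 y - \<alpha> * ?L3 y) = integral {0<..<1} ?L2 - \<alpha> * integral {0<..<1} ?L3"
      by simp
    then show ?thesis by (simp only: integral_open_interval_real)
  qed
  have im1: "(\<lambda>y. b * y) ` {0<..<1} = {0<..<b}"
  proof -
    have "x \<in> (\<lambda>y. b * y) ` {0<..<1}" if "x \<in> {0<..<b}" for x
      using that b by (intro image_eqI[of _ _ "x / b"]) auto
    then show ?thesis using b by auto
  qed
  have im2: "(\<lambda>y. b / y) ` {0<..<1} = {b<..}"
  proof -
    have "x \<in> (\<lambda>y. b / y) ` {0<..<1}" if "x \<in> {b<..}" for x
      using that b by (intro image_eqI[of _ _ "b / x"]) auto
    moreover have "b < b / y" if "y \<in> {0<..<1}" for y using that b by (simp add: less_divide_eq mult_less_cancel_left2)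
    ultimately show ?thesis by auto
  qed
  have "F absolutely_integrable_on {0<..<b} \<and> integral {0<..<b} F = integral {0..1} ?L1"
    unfolding im1[symmetric]
  proof (subst has_absolute_integral_change_of_variables_1'[symmetric])
    show "((\<lambda>y. b * y) has_real_derivative b) (at x within {0<..<1})" for x
      by (auto intro!: derivative_eq_intros)
    show "inj_on (\<lambda>y. b * y) {0<..<1}" using b by (auto intro: inj_onI)
    show "(\<lambda>y. \<bar>b\<bar> * F (b * y)) absolutely_integrable_on {0<..<1} \<and>
        integral {0<..<1} (\<lambda>y. \<bar>b\<bar> * F (b * y)) = integral {0..1} ?L1"
      unfolding F1 using a1 i1 by blast
  qed auto
  moreover have "F absolutely_integrable_on {b<..} \<and> integral {b<..} F = integral {0..1} ?L2 - \<alpha> * integral {0..1} ?L3"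
    unfolding im2[symmetric]
  proof (subst has_absolute_integral_change_of_variables_1'[symmetric])
    show "((\<lambda>y. b / y) has_real_derivative - b / x\<^sup>2) (at x within {0<..<1})" if "x \<in> {0<..<1}" for x
      using that by (auto intro!: derivative_eq_intros simp: power2_eq_square)
    show "inj_on (\<lambda>y. b / y) {0<..<1}" using b by (auto intro!: inj_onI simp: field_simps)
    have "(\<lambda>y. \<bar>- b / y\<^sup>2\<bar> * F (b / y)) absolutely_integrable_on {0<..<1}"
      using a3 F2 by (subst set_integrable_cong[OF refl refl F2]) auto
    moreover have "integral {0<..<1} (\<lambda>y. \<bar>- b / y\<^sup>2\<bar> * F (b / y)) = integral {0..1} ?L2 - \<alpha> * integral {0..1} ?L3"
      unfolding i2[symmetric] by (rule integral_cong) (rule F2)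
    ultimately show "(\<lambda>y. \<bar>- b / y\<^sup>2\<bar> * F (b / y)) absolutely_integrable_on {0<..<1} \<and>
        integral {0<..<1} (\<lambda>y. \<bar>- b / y\<^sup>2\<bar> * F (b / y)) = integral {0..1} ?L2 - \<alpha> * integral {0..1} ?L3" by blast
  qed auto
  ultimately have A: "F absolutely_integrable_on {0<..<b}" "F absolutely_integrable_on {b<..}"
    and I: "integral {0<..<b} F = integral {0..1} ?L1" "integral {b<..} F = integral {0..1} ?L2 - \<alpha> * integral {0..1} ?L3"
    by auto
  have un: "{0<..<b} \<union> {b<..} = {0<..} - {b}" using b by auto
  have AU: "F absolutely_integrable_on {0<..} - {b}"
    unfolding un[symmetric] using A by (intro set_integrable_Un) auto
  have "integral ({0<..<b} \<union> {b<..}) F = integral {0<..<b} F + integral {b<..} F"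
  proof (rule Henstock_Kurzweil_Integration.integral_Un)
    have "{0<..<b} \<inter> {b<..} = {}" by auto
    then show "negligible ({0<..<b} \<inter> {b<..})" by simp
  qed (use A in \<open>blast intro: set_lebesgue_integral_eq_integral(1)\<close>)+
  then have IU: "integral ({0<..} - {b}) F = integral {0..1} ?L1 + (integral {0..1} ?L2 - \<alpha> * integral {0..1} ?L3)"
    unfolding un I .
  have AF: "F absolutely_integrable_on {0<..}"
    using AU by (rule absolutely_integrable_spike_set) (auto intro: negligible_subset[of "{b}"])
  have IF: "integral {0<..} F = integral {0..1} ?L1 + (integral {0..1} ?L2 - \<alpha> * integral {0..1} ?L3)"
    unfolding IU[symmetric] by (rule integral_spike_set) (auto intro: negligible_subset[of "{b}"])
  have meas: "(\<lambda>x. indicator {0<..} x *\<^sub>R F x) \<in> borel_measurable lborel"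
    unfolding F_def by measurable
  have "(LINT x:{0<..}|lborel. F x) = (LINT x:{0<..}|lebesgue. F x)"
    unfolding set_lebesgue_integral_def by (rule integral_completion[symmetric, OF meas])
  also have "\<dots> = integral {0<..} F" by (rule set_lebesgue_integral_eq_integral(2)[OF AF])
  finally have "(LINT x:{0<..}|lborel. F x) = integral {0..1} ?L1 + (integral {0..1} ?L2 - \<alpha> * integral {0..1} ?L3)"
    unfolding IF .
  also have "integral {0..1} ?L1 + (integral {0..1} ?L2 - \<alpha> * integral {0..1} ?L3)
      = integral {0..1} (\<lambda>y. ?K y * (ln (1 + (b * y) powr \<alpha>) + ln (y powr \<alpha> + b powr \<alpha>))) - \<alpha> * integral {0..1} ?L3"
    unfolding distrib_left by (subst integral_add[OF integrable_continuous_real[OF c1] integrable_continuous_real[OF c2]]) simp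
  finally have "(LINT x:{0<..}|lborel. F x) = \<dots>" .
  then show ?thesis unfolding g_def F_def set_integral_mult_right \<theta>_def by simp
qed

text \<open>In the form given by \<open>g_eq_folded\<close> the part of the integrand that depends on \<open>b\<close> has a \<open>b\<close>-derivative
that is jointly continuous on \<open>(0,\<infinity>) \<times> [0,1]\<close>, so one may differentiate under the integral sign.\<close>

lemma g_has_derivative:
  assumes \<alpha>: "0 < \<alpha>" and \<rho>: "0 < \<rho>" "\<rho> < 1" and \<beta>: "0 < \<beta>"
  shows "(g \<alpha> \<rho> has_real_derivative
      \<alpha> / (pi * \<beta>) * integral {0..1} (\<lambda>y. poisson_kernel (pi * \<rho>) y * folded_profile \<alpha> \<beta> y)) (at \<beta>)"
proof -
  define \<theta> where "\<theta> = pi * \<rho>"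
  have \<theta>: "0 < \<theta>" "\<theta> < pi" using \<rho> by (auto simp: \<theta>_def)
  let ?K = "poisson_kernel \<theta>"
  let ?f = "\<lambda>b y. ?K y * (ln (1 + (b * y) powr \<alpha>) + ln (y powr \<alpha> + b powr \<alpha>))"
  let ?f' = "\<lambda>b y. ?K y * (\<alpha> / b * folded_profile \<alpha> b y)"
  have D: "((\<lambda>b. integral (cbox 0 1) (?f b)) has_real_derivative integral (cbox 0 1) (?f' \<beta>)) (at \<beta> within {0<..})"
  proof (rule leibniz_rule_field_derivative)
    fix b y :: real assume b: "b \<in> {0<..}" and y: "y \<in> cbox 0 1"
    have d1: "((\<lambda>b. ln (1 + (b * y) powr \<alpha>)) has_real_derivative \<alpha> / b * ((b * y) powr \<alpha> / (1 + (b * y) powr \<alpha>))) (at b within {0<..})"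
    proof (cases "y = 0")
      case False
      then have pby: "0 < b * y" using b y by simp
      have "((\<lambda>b. ln (1 + (b * y) powr \<alpha>)) has_real_derivative 1 / (1 + (b * y) powr \<alpha>) * (\<alpha> * (b * y) powr (\<alpha> - 1) * y)) (at b within {0<..})"
        using pby by (auto intro!: derivative_eq_intros add_pos_nonneg)
      moreover have "(b * y) powr (\<alpha> - 1) * y = (b * y) powr \<alpha> / b"
        using pby b by (simp add: powr_diff)
      ultimately show ?thesis by (simp add: mult.assoc mult.commute[of b])
    qed auto
    have d2: "((\<lambda>b. ln (y powr \<alpha> + b powr \<alpha>)) has_real_derivative \<alpha> / b * (b powr \<alpha> / (y powr \<alpha> + b powr \<alpha>))) (at b within {0<..})"
    proof -
      have p: "0 < y powr \<alpha> + b powr \<alpha>" using b by (simp add: add_nonneg_pos)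
      have "((\<lambda>b. ln (y powr \<alpha> + b powr \<alpha>)) has_real_derivative 1 / (y powr \<alpha> + b powr \<alpha>) * (\<alpha> * b powr (\<alpha> - 1))) (at b within {0<..})"
        using p b by (auto intro!: derivative_eq_intros)
      moreover have "b powr (\<alpha> - 1) = b powr \<alpha> / b" using b by (simp add: powr_diff)
      ultimately show ?thesis by (simp add: mult.commute[of b])
    qed
    show "((\<lambda>b. ?f b y) has_real_derivative ?f' b y) (at b within {0<..})"
      unfolding folded_profile_def distrib_left[of "\<alpha> / b"] by (intro DERIV_cmult DERIV_add d1 d2)
  next
    fix b :: real assume b: "b \<in> {0<..}"
    have "continuous_on {0..1} (?f b)"
      using \<alpha> b \<theta> by (auto intro!: continuous_intros continuous_on_powr' continuous_on_poisson_kernel simp: add_nonneg_eq_0_iff)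
    then show "?f b integrable_on cbox 0 1" unfolding cbox_interval by (rule integrable_continuous_real)
  next
    have "continuous_on ({0<..} \<times> {0..1}) (\<lambda>x. ?K (snd x))"
      using \<theta> by (intro continuous_on_compose2[OF continuous_on_poisson_kernel]) (auto intro!: continuous_intros)
    then show "continuous_on ({0<..} \<times> cbox 0 1) (\<lambda>(b, y). ?f' b y)"
      unfolding folded_profile_def case_prod_beta using \<alpha>
      by (auto intro!: continuous_intros continuous_on_powr' simp: add_nonneg_eq_0_iff)
  qed (use \<beta> in auto)
  have "at \<beta> within {0<..} = at \<beta>" using \<beta> by (simp add: at_within_open[of _ "{0<..}"])
  note D = D[unfolded this]
  have "((\<lambda>b. (integral {0..1} (?f b) - \<alpha> * integral {0..1} (\<lambda>y. ?K y * ln y)) / pi) has_real_derivative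
      (integral {0..1} (?f' \<beta>) - 0) / pi) (at \<beta>)"
    using D \<beta> unfolding cbox_interval by (intro DERIV_cdivide DERIV_diff DERIV_const)
  then have "(g \<alpha> \<rho> has_real_derivative (integral {0..1} (?f' \<beta>) - 0) / pi) (at \<beta>)"
    by (rule has_field_derivative_transform_within_open[of _ _ _ "{0<..}"])
      (use \<alpha> \<rho> \<beta> in \<open>auto simp: g_eq_folded \<theta>_def\<close>)
  also have "(integral {0..1} (?f' \<beta>) - 0) / pi = \<alpha> / (pi * \<beta>) * integral {0..1} (\<lambda>y. ?K y * folded_profile \<alpha> \<beta> y)"
  proof -
    have "?f' \<beta> = (\<lambda>y. \<alpha> / \<beta> * (?K y * folded_profile \<alpha> \<beta> y))" by (auto simp: fun_eq_iff)
    then show ?thesis by simp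
  qed
  finally show ?thesis by (simp only: \<theta>_def)
qed

section \<open>Alternating series with poles at the integers\<close>

text \<open>Integrated termwise, the sawtooth series gives \<open>x\<^sup>2/4\<close>. The partial sums of the derivative series
converge uniformly on \<open>[0,c]\<close> for \<open>c < \<pi>\<close>, so the mean value inequality proves the identity there; the
endpoint \<open>\<pi>\<close> follows by continuity.\<close>

lemma alternating_cosine_squares:
  assumes x: "0 \<le> x" "x \<le> pi"
  shows "(\<Sum>m. (-1)^m * cos (real m * x) / (real m)\<^sup>2) = (\<Sum>m. (-1)^m / (real m)\<^sup>2) + x\<^sup>2/4"
proof -
  let ?t = "\<lambda>m x. (-1)^m * cos (real m * x) / (real m)\<^sup>2"
  let ?B = "\<lambda>x. \<Sum>m. ?t m x"
  have sq: "summable (\<lambda>m. 1 / (real m)\<^sup>2)"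
    using inverse_power_summable[of 2, where ?'a=real] by (simp add: field_simps)
  have bd: "norm (?t m x) \<le> 1 / (real m)\<^sup>2" for m x
    by (simp add: abs_mult divide_right_mono)
  have ul: "uniform_limit UNIV (\<lambda>n x. \<Sum>m<n. ?t m x) ?B sequentially"
    by (rule Weierstrass_m_test[OF bd sq])
  have ct: "continuous_on UNIV (?t m)" for m
    by (cases "m = 0") (auto intro!: continuous_intros)
  have cont: "continuous_on UNIV ?B"
    by (rule uniform_limit_theorem[OF _ ul]) (auto intro!: always_eventually continuous_on_sum ct)
  have lim: "(\<lambda>n. \<Sum>m<Suc n. ?t m x) \<longlonglongrightarrow> ?B x" for x
    using LIMSEQ_Suc[OF tendsto_uniform_limitI[OF ul, of x]] by simp
  have main: "?B c - ?B 0 - c\<^sup>2/4 = 0" if c: "0 \<le> c" "c < pi" for c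
  proof -
    let ?h = "\<lambda>N x. (\<Sum>m<Suc N. ?t m x) - x\<^sup>2/4"
    have cp: "0 < cos (c/2)" using c by (intro cos_gt_zero_pi) auto
    have b: "norm (?h N c - ?h N 0) \<le> 1 / (real (Suc N) * cos (c/2)) * norm (c - 0)" for N
    proof (rule field_differentiable_bound[of "{0..c}"])
      fix x assume x: "x \<in> {0..c}"
      let ?d = "(\<Sum>m<N. (-1)^m * sin (real (Suc m) * x) / real (Suc m)) - x/2"
      have dt: "(?t m has_real_derivative - ((-1)^m * sin (real m * x) / real m)) (at x within {0..c})" for m
        by (cases "m = 0") (auto intro!: derivative_eq_intros simp: power2_eq_square)
      have "(?h N has_real_derivative (\<Sum>m<Suc N. - ((-1)^m * sin (real m * x) / real m)) - x/2) (at x within {0..c})"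
        by (intro DERIV_diff DERIV_sum dt) (auto intro!: derivative_eq_intros)
      also have "(\<Sum>m<Suc N. - ((-1)^m * sin (real m * x) / real m)) = (\<Sum>m<N. (-1)^m * sin (real (Suc m) * x) / real (Suc m))"
        by (subst sum.lessThan_Suc_shift) (simp del: of_nat_Suc)
      finally show "(?h N has_real_derivative ?d) (at x within {0..c})" .
      have "cos (c/2) \<le> cos (x/2)" using x c by (intro cos_monotone_0_pi_le) auto
      then have "1 / (real (Suc N) * cos (x/2)) \<le> 1 / (real (Suc N) * cos (c/2))"
        using cp by (intro divide_left_mono mult_left_mono mult_pos_pos) auto
      then show "norm ?d \<le> 1 / (real (Suc N) * cos (c/2))"
        using sawtooth_partial_sum[of x N] x c by simp
    qed (use c in auto)
    have "(\<lambda>N. ?h N c - ?h N 0) \<longlonglongrightarrow> (?B c - c\<^sup>2/4) - (?B 0 - 0\<^sup>2/4)"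
      by (intro tendsto_diff lim tendsto_const)
    moreover have "(\<lambda>N. 1 / (real (Suc N) * cos (c/2)) * norm (c - 0)) \<longlonglongrightarrow> 0"
      using tendsto_mult_right_zero[OF LIMSEQ_inverse_real_of_nat, of "norm (c-0) / cos (c/2)"] by (simp add: field_simps)
    then have "(\<lambda>N. ?h N c - ?h N 0) \<longlonglongrightarrow> 0"
      by (rule Lim_null_comparison[rotated]) (use b in \<open>auto intro!: always_eventually\<close>)
    ultimately have "(?B c - c\<^sup>2/4) - (?B 0 - 0\<^sup>2/4) = 0" by (rule LIMSEQ_unique)
    then show ?thesis by simp
  qed
  have "?B x - ?B 0 - x\<^sup>2/4 = 0"
  proof (rule continuous_constant_on_closure[of "{0..<pi}" "\<lambda>x. ?B x - ?B 0 - x\<^sup>2/4"])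
    show "continuous_on (closure {0..<pi}) (\<lambda>x. ?B x - ?B 0 - x\<^sup>2/4)"
      by (intro continuous_intros continuous_on_subset[OF cont]) auto
    show "x \<in> closure {0..<pi}" using x by (simp add: closure_atLeastLessThan)
  qed (use main in auto)
  then show ?thesis by simp
qed

lemma cosine_series_has_derivative:
  fixes c :: "nat \<Rightarrow> real"
  assumes s: "summable (\<lambda>m. (real m)\<^sup>2 * \<bar>c m\<bar>)"
  shows "((\<lambda>x. \<Sum>m. c m * cos (real m * x)) has_real_derivative - (\<Sum>m. real m * c m * sin (real m * x))) (at x)"
    and "((\<lambda>x. \<Sum>m. real m * c m * sin (real m * x)) has_real_derivative (\<Sum>m. (real m)\<^sup>2 * c m * cos (real m * x))) (at x)"
proof -
  have s1: "summable (\<lambda>m. real m * \<bar>c m\<bar>)"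
    by (rule summable_comparison_test'[OF s]) (simp add: abs_mult power2_eq_square mult_le_cancel_right1 mult_right_mono)
  have s0: "summable (\<lambda>m. c m)"
    by (rule summable_comparison_test'[OF s1, of 1]) (simp add: mult_le_cancel_right1)
  have b1: "norm (- (real m * c m * sin (real m * x))) \<le> real m * \<bar>c m\<bar>" for m x
    by (simp add: abs_mult mult_left_le)
  have "((\<lambda>x. \<Sum>m. c m * cos (real m * x)) has_real_derivative (\<Sum>m. - (real m * c m * sin (real m * x)))) (at x)"
    by (rule has_field_derivative_series'(2)[OF convex_UNIV, where ?x0.0=0, OF _ Weierstrass_m_test'[OF b1 s1]])
      (auto intro!: derivative_eq_intros s0)
  moreover have "(\<Sum>m. - (real m * c m * sin (real m * x))) = - (\<Sum>m. real m * c m * sin (real m * x))"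
    by (rule suminf_minus, rule summable_comparison_test'[OF s1]) (use b1 in simp)
  ultimately show "((\<lambda>x. \<Sum>m. c m * cos (real m * x)) has_real_derivative - (\<Sum>m. real m * c m * sin (real m * x))) (at x)"
    by simp
  have b2: "norm ((real m)\<^sup>2 * c m * cos (real m * x)) \<le> (real m)\<^sup>2 * \<bar>c m\<bar>" for m x
    by (simp add: abs_mult mult_left_le)
  show "((\<lambda>x. \<Sum>m. real m * c m * sin (real m * x)) has_real_derivative (\<Sum>m. (real m)\<^sup>2 * c m * cos (real m * x))) (at x)"
    by (rule has_field_derivative_series'(2)[OF convex_UNIV, where ?x0.0=0, OF _ Weierstrass_m_test'[OF b2 s]])
      (auto intro!: derivative_eq_intros simp: power2_eq_square)
qed

lemma harmonic_oscillator_unique: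
  fixes f f' :: "real \<Rightarrow> real"
  assumes a: "a \<noteq> 0"
    and d1: "\<And>x. 0 \<le> x \<Longrightarrow> x \<le> L \<Longrightarrow> (f has_real_derivative f' x) (at x)"
    and d2: "\<And>x. 0 \<le> x \<Longrightarrow> x \<le> L \<Longrightarrow> (f' has_real_derivative - (a\<^sup>2 * f x)) (at x)"
    and f0: "f' 0 = 0" and x: "0 \<le> x" "x \<le> L"
  shows "f' x = - (a * f 0 * sin (a * x))"
proof -
  have e: "\<exists>k. \<forall>x\<in>{0..L}. P x = k" if "\<And>x. 0 \<le> x \<Longrightarrow> x \<le> L \<Longrightarrow> (P has_real_derivative 0) (at x)" for P :: "real \<Rightarrow> real"
    using has_field_derivative_zero_constant[of "{0..L}" P] that by (metis atLeastAtMost_iff convex_real_interval(5) has_field_derivative_at_within)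
  have "\<exists>k. \<forall>x\<in>{0..L}. a * f x * cos (a*x) - f' x * sin (a*x) = k"
  proof (rule e)
    fix x assume "0 \<le> x" "x \<le> L"
    then show "((\<lambda>x. a * f x * cos (a*x) - f' x * sin (a*x)) has_real_derivative 0) (at x)"
      by (auto intro!: derivative_eq_intros d1 d2 simp: power2_eq_square)
  qed
  then obtain k where k: "\<And>x. x\<in>{0..L} \<Longrightarrow> a * f x * cos (a*x) - f' x * sin (a*x) = k" by blast
  have A: "a * f x * cos (a*x) - f' x * sin (a*x) = a * f 0" using k[of x] k[of 0] x f0 by simp
  have "\<exists>k. \<forall>x\<in>{0..L}. a * f x * sin (a*x) + f' x * cos (a*x) = k"
  proof (rule e)
    fix x assume "0 \<le> x" "x \<le> L"
    then show "((\<lambda>x. a * f x * sin (a*x) + f' x * cos (a*x)) has_real_derivative 0) (at x)"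
      by (auto intro!: derivative_eq_intros d1 d2 simp: power2_eq_square)
  qed
  then obtain l where l: "\<And>x. x\<in>{0..L} \<Longrightarrow> a * f x * sin (a*x) + f' x * cos (a*x) = l" by blast
  have B: "a * f x * sin (a*x) + f' x * cos (a*x) = 0" using l[of x] l[of 0] x f0 by simp
  have "f' x = f' x * ((sin (a*x))\<^sup>2 + (cos (a*x))\<^sup>2)" by simp
  also have "\<dots> = cos (a*x) * (a * f x * sin (a*x) + f' x * cos (a*x)) - sin (a*x) * (a * f x * cos (a*x) - f' x * sin (a*x))"
    unfolding power2_eq_square by (simp only: algebra_simps)
  finally show ?thesis unfolding A B by simp
qed

text \<open>Vanishes for \<open>m = 0\<close> and for \<open>m = a\<close>, both times because of \<open>1/0 = 0\<close>.\<close>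

definition pole_coeff :: "real \<Rightarrow> nat \<Rightarrow> real" where
  "pole_coeff a m = (-1)^m / ((real m)\<^sup>2 * ((real m)\<^sup>2 - a\<^sup>2))"

lemma summable_pole_coeff: "summable (\<lambda>m. (real m)\<^sup>2 * \<bar>pole_coeff a m\<bar>)"
proof -
  have "(\<lambda>m. (real m)\<^sup>2 * (1 / ((real m)\<^sup>2 * \<bar>(real m)\<^sup>2 - a\<^sup>2\<bar>))) \<in> O(\<lambda>m. 1 / (real m)\<^sup>2)"
    by real_asymp
  moreover have "(real m)\<^sup>2 * (1 / ((real m)\<^sup>2 * \<bar>(real m)\<^sup>2 - a\<^sup>2\<bar>)) = (real m)\<^sup>2 * \<bar>pole_coeff a m\<bar>" for m
    by (simp add: pole_coeff_def abs_mult)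
  ultimately have "(\<lambda>m. (real m)\<^sup>2 * \<bar>pole_coeff a m\<bar>) \<in> O(\<lambda>m. 1 / (real m)\<^sup>2)" by simp
  moreover have "summable (\<lambda>m. norm (1 / (real m)\<^sup>2))"
    using inverse_power_summable[of 2, where ?'a=real] by (simp add: field_simps)
  ultimately show ?thesis by (rule summable_comparison_test_bigo[rotated])
qed

text \<open>For \<open>F(x) = \<Sum>m. pole_coeff a m * cos(mx)\<close> one has \<open>m\<^sup>2 / (m\<^sup>2(m\<^sup>2 - a\<^sup>2)) = 1/m\<^sup>2 + a\<^sup>2 / (m\<^sup>2(m\<^sup>2 - a\<^sup>2))\<close>, so
\<open>F''\<close> is \<open>-a\<^sup>2F\<close> minus the series of \<open>alternating_cosine_squares\<close>, corrected by \<open>r cos(ax)\<close> for the missing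
term \<open>m = a\<close>. Subtracting a particular solution leaves a harmonic oscillator that starts with
velocity \<open>0\<close>. The left-hand side is \<open>-F'(x)\<close>; it still involves the unknown value of
\<open>\<Sum>m. m\<^sup>2 * pole_coeff a m\<close>, which the next lemmas determine.\<close>

lemma pole_sine_series:
  assumes a: "0 < a" and x: "0 \<le> x" "x \<le> pi"
    and r: "\<And>n. a = real n \<Longrightarrow> r = (-1)^n / a\<^sup>2" "a \<notin> \<nat> \<Longrightarrow> r = 0"
  shows "(\<Sum>m. real m * pole_coeff a m * sin (real m * x)) =
    x / (2 * a\<^sup>2) - r * (sin (a * x) + a * x * cos (a * x)) / (2 * a)
    + ((\<Sum>m. (real m)\<^sup>2 * pole_coeff a m) + r - 1 / (2 * a\<^sup>2)) / a * sin (a * x)"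
proof -
  let ?c = "pole_coeff a"
  define F where "F = (\<lambda>x. \<Sum>m. ?c m * cos (real m * x))"
  define S where "S = (\<lambda>x. \<Sum>m. real m * ?c m * sin (real m * x))"
  define C where "C = (\<lambda>x. \<Sum>m. (real m)\<^sup>2 * ?c m * cos (real m * x))"
  define B0 where "B0 = (\<Sum>m. (-1)^m / (real m)\<^sup>2 :: real)"
  have dF: "(F has_real_derivative - S x) (at x)" for x
    unfolding F_def S_def by (rule cosine_series_has_derivative(1)[OF summable_pole_coeff])
  have dS: "(S has_real_derivative C x) (at x)" for x
    unfolding S_def C_def by (rule cosine_series_has_derivative(2)[OF summable_pole_coeff])
  have C: "C x = B0 + x\<^sup>2/4 - r * cos (a * x) + a\<^sup>2 * F x" if "0 \<le> x" "x \<le> pi" for x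
  proof -
    have sq: "summable (\<lambda>m. 1 / (real m)\<^sup>2)"
      using inverse_power_summable[of 2, where ?'a=real] by (simp add: field_simps)
    have "summable (\<lambda>m. (-1)^m * cos (real m * x) / (real m)\<^sup>2)"
      by (rule summable_comparison_test'[OF sq]) (simp add: abs_mult divide_right_mono)
    then have s1: "(\<lambda>m. (-1)^m * cos (real m * x) / (real m)\<^sup>2) sums (B0 + x\<^sup>2/4)"
      using alternating_cosine_squares[OF that] by (simp add: sums_iff B0_def)
    have "summable (\<lambda>m. ?c m * cos (real m * x))"
      by (rule summable_comparison_test'[OF summable_pole_coeff[of a], of 1])
        (auto simp: abs_mult intro!: mult_mono order_trans[OF mult_left_le[OF abs_cos_le_one]] simp: mult_le_cancel_right1)
    then have s2: "(\<lambda>m. a\<^sup>2 * (?c m * cos (real m * x))) sums (a\<^sup>2 * F x)"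
      unfolding F_def by (intro sums_mult summable_sums)
    have s3: "(\<lambda>m. if real m = a then r * cos (a * x) else 0) sums (r * cos (a * x))"
    proof (cases "a \<in> \<nat>")
      case True
      then obtain n where "a = real n" by (auto elim: Nats_cases)
      then show ?thesis using sums_single[of n "\<lambda>_. r * cos (a * x)"] by simp
    next
      case False
      then have "(if real m = a then r * cos (a * x) else 0) = 0" for m using r(2) by auto
      then show ?thesis using r(2) False by simp
    qed
    have "(real m)\<^sup>2 * ?c m * cos (real m * x) = (-1)^m * cos (real m * x) / (real m)\<^sup>2
        - (if real m = a then r * cos (a * x) else 0) + a\<^sup>2 * (?c m * cos (real m * x))" for m
    proof -
      consider "m = 0" | "m \<noteq> 0" "real m = a" | "m \<noteq> 0" "real m \<noteq> a" by blast
      then show ?thesis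
      proof cases
        case 1 then show ?thesis using a by (simp add: pole_coeff_def)
      next
        case 2 then show ?thesis using r(1)[of m] by (simp add: pole_coeff_def)
      next
        case 3
        then have "(real m)\<^sup>2 - a\<^sup>2 \<noteq> 0" using a by (simp add: power2_eq_iff)
        then have "(real m)\<^sup>2 * ?c m = (-1)^m / (real m)\<^sup>2 + a\<^sup>2 * ?c m"
          using 3 by (simp add: pole_coeff_def divide_simps) (simp add: algebra_simps)
        then have "(real m)\<^sup>2 * ?c m * cos (real m * x) = ((-1)^m / (real m)\<^sup>2 + a\<^sup>2 * ?c m) * cos (real m * x)" by simp
        then show ?thesis using 3 by (simp add: algebra_simps)
      qed
    qed
    then show ?thesis unfolding C_def using sums_add[OF sums_diff[OF s1 s3] s2] by (simp add: sums_iff)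
  qed
  \<comment> \<open>The polynomial terms remove \<open>B0 + x\<^sup>2/4\<close>, and \<open>x sin(ax)\<close> removes the resonant forcing \<open>r cos(ax)\<close>.\<close>
  define E where "E = (\<lambda>x. F x + (B0 + x\<^sup>2/4) / a\<^sup>2 - 1 / (2 * a^4) - r * x * sin (a * x) / (2 * a))"
  define E' where "E' = (\<lambda>x. - S x + x / (2 * a\<^sup>2) - r * (sin (a * x) + a * x * cos (a * x)) / (2 * a))"
  have "E' x = - (a * E 0 * sin (a * x))"
  proof (rule harmonic_oscillator_unique[OF _ _ _ _ x])
    fix x assume x: "0 \<le> x" "x \<le> pi"
    show "(E has_real_derivative E' x) (at x)"
      unfolding E_def E'_def using a
      by (auto intro!: derivative_eq_intros dF simp: field_simps power2_eq_square)
    have "(E' has_real_derivative - C x + 1 / (2 * a\<^sup>2) - r * (a * cos (a * x) + (a * cos (a * x) - a * x * a * sin (a * x))) / (2 * a)) (at x)"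
      unfolding E'_def using a by (auto intro!: derivative_eq_intros dS simp: field_simps)
    also have "- C x + 1 / (2 * a\<^sup>2) - r * (a * cos (a * x) + (a * cos (a * x) - a * x * a * sin (a * x))) / (2 * a) = - (a\<^sup>2 * E x)"
      unfolding C[OF x] E_def using a by (simp add: field_simps power2_eq_square power4_eq_xxxx)
    finally show "(E' has_real_derivative - (a\<^sup>2 * E x)) (at x)" .
  qed (use a in \<open>auto simp: E'_def S_def\<close>)
  moreover have "a * E 0 = (C 0 + r - 1 / (2 * a\<^sup>2)) / a"
    using a C[of 0] by (simp add: E_def field_simps power2_eq_square power4_eq_xxxx)
  ultimately show ?thesis by (simp add: E'_def S_def C_def algebra_simps)
qed

lemma sin_pi_nonzero:
  fixes a :: real
  assumes "0 \<le> a" "a \<notin> \<nat>"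
  shows "sin (a * pi) \<noteq> 0"
proof
  assume "sin (a * pi) = 0"
  then obtain i :: int where "a = of_int i" by (auto simp: sin_zero_iff_int2)
  then have "a = real (nat i)" using assms by simp
  then show False using assms by (metis of_nat_in_Nats)
qed

text \<open>At \<open>x = \<pi>\<close> the sine series vanishes term by term; solving \<open>pole_sine_series\<close> for the unknown sum gives the
partial fraction expansion of the cosecant.\<close>

lemma pole_sum_noninteger:
  assumes a: "0 < a" "a \<notin> \<nat>"
  shows "(\<Sum>m. (real m)\<^sup>2 * pole_coeff a m) = 1 / (2 * a\<^sup>2) - pi / (2 * a * sin (a * pi))"
proof -
  have na: "a \<noteq> real n" for n using a by auto
  have "0 = pi / (2 * a\<^sup>2) + ((\<Sum>m. (real m)\<^sup>2 * pole_coeff a m) - 1 / (2 * a\<^sup>2)) / a * sin (a * pi)"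
    using pole_sine_series[of a pi 0, OF a(1)] na by simp
  then show ?thesis using a sin_pi_nonzero[of a] by (simp add: field_simps power2_eq_square)
qed

lemma pole_sine_noninteger:
  assumes a: "0 < a" "a \<notin> \<nat>" and x: "0 \<le> x" "x \<le> pi"
  shows "(\<Sum>m. real m * pole_coeff a m * sin (real m * x)) =
    x / (2 * a\<^sup>2) - pi * sin (a * x) / (2 * a\<^sup>2 * sin (a * pi))"
proof -
  have na: "a \<noteq> real n" for n using a by auto
  show ?thesis
    using pole_sine_series[of a x 0, OF a(1) x] na unfolding pole_sum_noninteger[OF a]
    by (simp add: power2_eq_square mult_ac)
qed

text \<open>At an integer \<open>sin(n\<pi>) = 0\<close>, and \<open>pole_sine_series\<close> at \<open>\<pi>\<close> carries no information. Instead
\<open>2n / (m\<^sup>2 - n\<^sup>2) = 1/(m - n) - 1/(m + n)\<close> makes the sum telescope into two sections of the alternating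
harmonic series, which cancel in the limit except for finitely many terms.\<close>

lemma pole_sum_integer:
  assumes n: "n \<ge> 1"
  shows "(\<Sum>m. (real m)\<^sup>2 * pole_coeff (real n) m) = 1 / (2 * (real n)\<^sup>2) + (-1)^n / (4 * (real n)\<^sup>2)"
proof -
  define h :: "nat \<Rightarrow> real" where "h = (\<lambda>M. \<Sum>j<M. (-1)^Suc j / real (Suc j))"
  have hS: "h (Suc M) = h M + (-1)^Suc M / real (Suc M)" for M by (simp add: h_def)
  have hlim: "h \<longlonglongrightarrow> - ln 2"
    using sums_minus[OF alternating_harmonic_series_sums] unfolding sums_def h_def by simp
  have h_sum: "h M = (\<Sum>j\<in>{1..M}. (-1)^j / real j)" for M
    by (induction M) (auto simp: h_def)
  define t where "t = (\<lambda>m. (real m)\<^sup>2 * pole_coeff (real n) m)"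
  have t: "2 * real n * t m = (-1)^m * (1 / (real m - real n) - 1 / (real m + real n))" if "m \<noteq> n" "m \<noteq> 0" for m
  proof -
    have "(real m)\<^sup>2 - (real n)\<^sup>2 = (real m - real n) * (real m + real n)" by (simp add: power2_eq_square algebra_simps)
    then show ?thesis using that n by (simp add: t_def pole_coeff_def divide_simps)
  qed
  have partial: "2 * real n * (\<Sum>m<Suc M. t m) = (-1)^n * (h (M - n) - h (M + n)) + 1 / real n + (-1)^n / (2 * real n)"
    if "M \<ge> n" for M
    using that
  proof (induction M rule: dec_induct)
    case base
    obtain n' where n': "n = Suc n'" using n by (cases n) auto
    have "2 * real n * (\<Sum>m<Suc n. t m) = (\<Sum>m<n. 2 * real n * t m)"
      by (simp add: t_def pole_coeff_def sum_distrib_left)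
    also have "\<dots> = (\<Sum>m\<in>{1..n'}. 2 * real n * t m)"
      by (intro sum.mono_neutral_right) (auto simp: n' t_def)
    also have "\<dots> = (\<Sum>m\<in>{1..n'}. (-1)^m / (real m - real n)) - (\<Sum>m\<in>{1..n'}. (-1)^m / (real m + real n))"
      by (subst sum_subtractf[symmetric], rule sum.cong[OF refl], subst t) (auto simp: n' right_diff_distrib)
    also have "(\<Sum>m\<in>{1..n'}. (-1)^m / (real m - real n)) = (\<Sum>j\<in>{1..n'}. - ((-1)^n * ((-1)^j / real j)))"
    proof (rule sum.reindex_bij_witness[of _ "\<lambda>j. n - j" "\<lambda>j. n - j"])
      fix m assume m: "m \<in> {1..n'}"
      have "(-1::real)^n = (-1)^(n-m) * (-1)^m" using m n' by (simp add: power_add[symmetric])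
      moreover have "(-1::real)^(n-m) * (-1)^(n-m) = 1" by (simp add: power_mult_distrib[symmetric])
      ultimately have "(-1::real)^n * (-1)^(n-m) = (-1)^m" by (simp add: mult_ac)
      then show "- ((-1)^n * ((-1)^(n - m) / real (n - m))) = (-1)^m / (real m - real n)"
        using m n' by (simp add: of_nat_diff field_simps)
    qed (auto simp: n')
    also have "\<dots> = - ((-1)^n * h n')" by (simp add: h_sum sum_distrib_left sum_negf)
    also have "(\<Sum>m\<in>{1..n'}. (-1)^m / (real m + real n)) = (-1)^n * (h (n + n') - h n)"
    proof -
      have "(-1)^n * (h (n + N) - h n) = (\<Sum>m\<in>{1..N}. (-1)^m / (real m + real n))" for N
      proof (induction N)
        case (Suc N)
        have "(-1::real)^n * (-1)^n = 1" by (simp add: power_mult_distrib[symmetric])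
        with Suc show ?case by (simp add: hS power_add algebra_simps)
      qed simp
      then show ?thesis by simp
    qed
    also have "- ((-1)^n * h n') - (-1)^n * (h (n + n') - h n) = (-1)^n * (h (n - n) - h (n + n)) + 1 / real n + (-1)^n / (2 * real n)"
    proof -
      have a: "(-1::real)^n * (-1)^n = 1" by (simp add: power_mult_distrib[symmetric])
      have "h n = h n' + (-1)^n / real n" by (simp add: n' hS)
      moreover have "h (n + n) = h (n + n') + 1 / (2 * real n)"
        using hS[of "n + n'"] by (simp add: n')
      moreover have "h (n - n) = 0" by (simp add: h_def)
      moreover have "(-1)^n * ((-1)^n / real n) = 1 / real n" using a by simp
      ultimately show ?thesis by (simp add: algebra_simps)
    qed
    finally show ?case .
  next
    case (step M)
    have "h (Suc M - n) = h (M - n) + (-1)^(Suc M - n) / (real (Suc M) - real n)"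
      using step.hyps by (simp add: Suc_diff_le hS of_nat_diff)
    moreover have "h (Suc M + n) = h (M + n) + (-1)^(Suc M + n) / (real (Suc M) + real n)"
      using hS[of "M + n"] by simp
    moreover have "2 * real n * t (Suc M) = (-1)^Suc M * (1 / (real (Suc M) - real n) - 1 / (real (Suc M) + real n))"
      by (rule t) (use step.hyps in auto)
    moreover have "(-1::real)^n * (-1)^(Suc M - n) = (-1)^Suc M"
      using step.hyps by (simp add: power_add[symmetric])
    moreover have "(-1::real)^n * (-1)^(Suc M + n) = (-1)^Suc M"
      by (simp add: power_add power_mult_distrib[symmetric] mult_ac)
    moreover have "(\<Sum>m<Suc (Suc M). t m) = (\<Sum>m<Suc M. t m) + t (Suc M)" by simp
    ultimately show ?case using step.IH
      by (simp only: distrib_left right_diff_distrib times_divide_eq_right mult_1_right)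
  qed
  have sm: "summable t"
    by (rule summable_comparison_test'[OF summable_pole_coeff[of n]]) (simp add: t_def abs_mult)
  then have "(\<lambda>M. 2 * real n * (\<Sum>m<Suc M. t m)) \<longlonglongrightarrow> 2 * real n * suminf t"
    by (intro tendsto_mult_left LIMSEQ_Suc summable_LIMSEQ)
  moreover have "(\<lambda>M. (-1)^n * (h (M - n) - h (M + n)) + 1 / real n + (-1)^n / (2 * real n))
      \<longlonglongrightarrow> (-1)^n * (- ln 2 - - ln 2) + 1 / real n + (-1)^n / (2 * real n)"
  proof -
    have "(\<lambda>M. h (M + n)) \<longlonglongrightarrow> - ln 2" by (rule LIMSEQ_ignore_initial_segment[OF hlim])
    moreover have "(\<lambda>M. h (M - n)) \<longlonglongrightarrow> - ln 2"
      by (rule filterlim_compose[OF hlim]) (rule filterlim_minus_const_nat_at_top)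
    ultimately show ?thesis by (intro tendsto_intros)
  qed
  then have "(\<lambda>M. 2 * real n * (\<Sum>m<Suc M. t m)) \<longlonglongrightarrow> (-1)^n * (- ln 2 - - ln 2) + 1 / real n + (-1)^n / (2 * real n)"
    by (rule Lim_transform_eventually) (use partial in \<open>auto intro!: eventually_sequentiallyI[of n] simp del: sum.lessThan_Suc\<close>)
  ultimately have "2 * real n * suminf t = (-1)^n * (- ln 2 - - ln 2) + 1 / real n + (-1)^n / (2 * real n)"
    by (rule LIMSEQ_unique)
  then show ?thesis using n by (simp add: t_def field_simps power2_eq_square)
qed

lemma pole_sine_integer:
  assumes n: "n \<ge> 1" and x: "0 \<le> x" "x \<le> pi"
  shows "(\<Sum>m. real m * pole_coeff (real n) m * sin (real m * x)) =
    x / (2 * (real n)\<^sup>2) - (-1)^n * x * cos (real n * x) / (2 * (real n)\<^sup>2) + 3 * (-1)^n * sin (real n * x) / (4 * real n ^ 3)"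
proof -
  have "(\<Sum>m. real m * pole_coeff (real n) m * sin (real m * x)) =
    x / (2 * (real n)\<^sup>2) - (-1)^n / (real n)\<^sup>2 * (sin (real n * x) + real n * x * cos (real n * x)) / (2 * real n)
    + ((1 / (2 * (real n)\<^sup>2) + (-1)^n / (4 * (real n)\<^sup>2)) + (-1)^n / (real n)\<^sup>2 - 1 / (2 * (real n)\<^sup>2)) / real n * sin (real n * x)"
    using pole_sine_series[of "real n" x "(-1)^n / (real n)\<^sup>2"] n x by (simp add: pole_sum_integer)
  also have "\<dots> = x / (2 * (real n)\<^sup>2) - (-1)^n * x * cos (real n * x) / (2 * (real n)\<^sup>2) + 3 * (-1)^n * sin (real n * x) / (4 * real n ^ 3)"
    using n by (simp add: field_simps power2_eq_square power3_eq_cube)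
  finally show ?thesis .
qed

section \<open>Power moments of the folded profile\<close>

text \<open>Termwise integration of \<open>1/(1 + u) = \<Sum>k. (-u)\<^sup>k\<close>, valid even where \<open>u\<close> reaches \<open>1\<close>: the remainder after
\<open>N\<close> terms is \<open>(-u)\<^sup>N / (1 + u)\<close>, whose integral against \<open>h\<close> is at most the \<open>N\<close>-th moment \<open>c N\<close>.\<close>

lemma alternating_geometric_integral:
  fixes h u :: "real \<Rightarrow> real"
  assumes c: "\<And>k. ((\<lambda>y. h y * u y ^ k) has_integral c k) {a..b}"
    and I: "((\<lambda>y. h y / (1 + u y)) has_integral I) {a..b}"
    and pos: "\<And>y. y \<in> {a..b} \<Longrightarrow> 0 \<le> h y" "\<And>y. y \<in> {a..b} \<Longrightarrow> 0 \<le> u y"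
    and lim: "c \<longlonglongrightarrow> 0"
  shows "(\<lambda>k. (-1)^k * c k) sums I"
proof -
  have b: "norm ((\<Sum>k<N. (-1)^k * c k) - I) \<le> c N" for N
  proof -
    let ?f = "\<lambda>y. (\<Sum>k<N. (-1)^k * (h y * u y ^ k)) - h y / (1 + u y)"
    have f: "(?f has_integral ((\<Sum>k<N. (-1)^k * c k) - I)) {a..b}"
      by (intro has_integral_diff has_integral_sum has_integral_mult_right c I) auto
    have "norm (integral {a..b} ?f) \<le> integral {a..b} (\<lambda>y. h y * u y ^ N)"
    proof (rule integral_norm_bound_integral)
      fix y assume y: "y \<in> {a..b}"
      have u: "0 \<le> u y" "0 \<le> h y" using pos y by auto
      have "(\<Sum>k<N. (-1)^k * (h y * u y ^ k)) = h y * (\<Sum>k<N. (- u y) ^ k)"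
        by (subst sum_distrib_left, rule sum.cong) (auto simp: power_minus[of "u y"])
      also have "(\<Sum>k<N. (- u y) ^ k) = (1 - (- u y)^N) / (1 + u y)"
        using u by (subst sum_gp_strict) auto
      finally have "?f y = - (h y * (- u y)^N / (1 + u y))"
        by (simp add: diff_divide_distrib right_diff_distrib)
      then have "norm (?f y) = h y * u y ^ N / (1 + u y)"
        using u by (simp add: abs_mult power_abs)
      also have "\<dots> \<le> h y * u y ^ N" using u by (simp add: divide_le_eq mult_le_cancel_left1 distrib_left)
      finally show "norm (?f y) \<le> h y * u y ^ N" .
    qed (use f c in blast)+
    then show ?thesis using integral_unique[OF f] integral_unique[OF c[of N]] by simp
  qed
  have "(\<lambda>N. (\<Sum>k<N. (-1)^k * c k) - I) \<longlonglongrightarrow> 0"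
    by (rule Lim_null_comparison[OF _ lim]) (use b in \<open>auto intro!: always_eventually\<close>)
  then show ?thesis unfolding sums_def using LIM_zero_iff by blast
qed

lemma powr_pow: "0 < x \<Longrightarrow> (x powr a) ^ n = x powr (a * real n)" for x a :: real
  by (subst powr_power) (auto simp: mult.commute)

lemma has_integral_power_powr:
  assumes n: "n \<ge> 1" and s: "0 \<le> s" and c: "0 \<le> c"
  shows "((\<lambda>y. y^(n-1) * y powr s) has_integral c powr (s + real n) / (s + real n)) {0..c}"
proof -
  have "((\<lambda>y. y powr (s + real n - 1)) has_integral c powr (s + real n - 1 + 1) / (s + real n - 1 + 1)) {0..c}"
    by (rule has_integral_powr_from_0) (use n s c in auto)
  then have "((\<lambda>y. y powr (s + real n - 1)) has_integral c powr (s + real n) / (s + real n)) {0..c}" by simp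
  then show ?thesis
  proof (rule has_integral_spike_finite[rotated 2])
    fix y assume "y \<in> {0..c} - {0}"
    then have "y > 0" by auto
    then have "y^(n-1) = y powr (real n - 1)" using n by (simp add: powr_realpow[symmetric] of_nat_diff)
    then show "y^(n-1) * y powr s = y powr (s + real n - 1)"
      by (simp only: powr_add[symmetric]) (simp add: algebra_simps)
  qed auto
qed

context
  fixes \<alpha> \<beta> :: real and n :: nat
  assumes \<alpha>: "0 < \<alpha>" and \<beta>: "0 < \<beta>" "\<beta> < 1" and n: "n \<ge> 1"
begin

text \<open>The three lemmas in this block expand the parts of the moment on which \<open>(\<beta>y)\<^sup>\<alpha>\<close>, \<open>(y/\<beta>)\<^sup>\<alpha>\<close> and \<open>(\<beta>/y)\<^sup>\<alpha>\<close>,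
respectively, are at most \<open>1\<close>.\<close>

lemma moment_inner:
  "(\<lambda>k. (-1)^k * (\<beta> powr (\<alpha> * real (Suc k)) / (\<alpha> * real (Suc k) + real n))) sums
    integral {0..1} (\<lambda>y. y^(n-1) * ((\<beta> * y) powr \<alpha> / (1 + (\<beta> * y) powr \<alpha>)))"
proof -
  have "(\<lambda>k. (-1)^k * (\<beta> powr (\<alpha> * real (Suc k)) * (1 powr (\<alpha> * real (Suc k) + real n) / (\<alpha> * real (Suc k) + real n)))) sums
    integral {0..1} (\<lambda>y. y^(n-1) * (\<beta> * y) powr \<alpha> / (1 + (\<beta> * y) powr \<alpha>))"
  proof (rule alternating_geometric_integral)
    fix k
    have "((\<lambda>y. \<beta> powr (\<alpha> * real (Suc k)) * (y^(n-1) * y powr (\<alpha> * real (Suc k)))) has_integral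
      \<beta> powr (\<alpha> * real (Suc k)) * (1 powr (\<alpha> * real (Suc k) + real n) / (\<alpha> * real (Suc k) + real n))) {0..1}"
      by (intro has_integral_mult_right has_integral_power_powr n) (use \<alpha> in auto)
    then show "((\<lambda>y. y^(n-1) * (\<beta> * y) powr \<alpha> * ((\<beta> * y) powr \<alpha>)^k) has_integral
      \<beta> powr (\<alpha> * real (Suc k)) * (1 powr (\<alpha> * real (Suc k) + real n) / (\<alpha> * real (Suc k) + real n))) {0..1}"
    proof (rule has_integral_eq[rotated])
      fix y :: real assume y: "y \<in> {0..1}"
      have "(\<beta> * y) powr \<alpha> * ((\<beta> * y) powr \<alpha>)^k = (\<beta> * y) powr (\<alpha> * real (Suc k))"
      proof (cases "y = 0")
        case False
        then have "0 < \<beta> * y" using y \<beta> by simp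
        then have "((\<beta> * y) powr \<alpha>)^Suc k = (\<beta> * y) powr (\<alpha> * real (Suc k))"
          by (rule powr_pow)
        then show ?thesis by simp
      qed simp
      then show "\<beta> powr (\<alpha> * real (Suc k)) * (y^(n-1) * y powr (\<alpha> * real (Suc k))) =
          y^(n-1) * (\<beta> * y) powr \<alpha> * ((\<beta> * y) powr \<alpha>)^k"
        using y \<beta> by (simp add: powr_mult mult_ac del: of_nat_Suc)
    qed
  next
    have "continuous_on {0..1} (\<lambda>y. y^(n-1) * (\<beta> * y) powr \<alpha> / (1 + (\<beta> * y) powr \<alpha>))"
      using \<alpha> \<beta> by (intro continuous_intros continuous_on_powr') (auto simp: add_nonneg_eq_0_iff)
    then show "((\<lambda>y. y^(n-1) * (\<beta> * y) powr \<alpha> / (1 + (\<beta> * y) powr \<alpha>)) has_integral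
      integral {0..1} (\<lambda>y. y^(n-1) * (\<beta> * y) powr \<alpha> / (1 + (\<beta> * y) powr \<alpha>))) {0..1}"
      by (intro integrable_integral integrable_continuous_real)
  next
    have "(\<lambda>k. 1 / (\<alpha> * real (Suc k) + real n)) \<longlonglongrightarrow> 0" using \<alpha> by real_asymp
    then show "(\<lambda>k. \<beta> powr (\<alpha> * real (Suc k)) * (1 powr (\<alpha> * real (Suc k) + real n) / (\<alpha> * real (Suc k) + real n))) \<longlonglongrightarrow> 0"
    proof (rule Lim_null_comparison[rotated], intro always_eventually allI)
      fix k
      have "\<beta> powr (\<alpha> * real (Suc k)) \<le> 1" using \<alpha> \<beta> by (intro powr_le1) auto
      then show "norm (\<beta> powr (\<alpha> * real (Suc k)) * (1 powr (\<alpha> * real (Suc k) + real n) / (\<alpha> * real (Suc k) + real n))) \<le> 1 / (\<alpha> * real (Suc k) + real n)"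
        using \<alpha> by (auto simp: abs_mult mult_le_cancel_right1 intro!: divide_right_mono)
    qed
  qed auto
  then show ?thesis by simp
qed

lemma moment_below:
  "(\<lambda>k. (-1)^k * (\<beta>^n / (\<alpha> * real k + real n))) sums
    integral {0..\<beta>} (\<lambda>y. y^(n-1) * (\<beta> powr \<alpha> / (y powr \<alpha> + \<beta> powr \<alpha>)))"
proof -
  have eq: "y^(n-1) / (1 + (y / \<beta>) powr \<alpha>) = y^(n-1) * (\<beta> powr \<alpha> / (y powr \<alpha> + \<beta> powr \<alpha>))" if "0 \<le> y" for y
  proof -
    have "(y / \<beta>) powr \<alpha> = y powr \<alpha> / \<beta> powr \<alpha>" using that \<beta> by (simp add: powr_divide)
    moreover have "1 / (1 + u / b) = b / (u + b)" if "0 \<le> u" "0 < b" for u b :: real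
      using that by (simp add: field_simps add_pos_nonneg)
    from this[of "y powr \<alpha>" "\<beta> powr \<alpha>"] \<beta>
    have "1 / (1 + y powr \<alpha> / \<beta> powr \<alpha>) = \<beta> powr \<alpha> / (y powr \<alpha> + \<beta> powr \<alpha>)" by simp
    ultimately show ?thesis by (metis times_divide_eq_right mult_1_right)
  qed
  have "(\<lambda>k. (-1)^k * (\<beta>^n / (\<alpha> * real k + real n))) sums
    integral {0..\<beta>} (\<lambda>y. y^(n-1) / (1 + (y / \<beta>) powr \<alpha>))"
  proof (rule alternating_geometric_integral)
    fix k
    have "((\<lambda>y. \<beta> powr (- (\<alpha> * real k)) * (y^(n-1) * y powr (\<alpha> * real k))) has_integral
      \<beta> powr (- (\<alpha> * real k)) * (\<beta> powr (\<alpha> * real k + real n) / (\<alpha> * real k + real n))) {0..\<beta>}"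
      by (intro has_integral_mult_right has_integral_power_powr n) (use \<alpha> \<beta> in auto)
    also have "\<beta> powr (- (\<alpha> * real k)) * (\<beta> powr (\<alpha> * real k + real n) / (\<alpha> * real k + real n)) = \<beta>^n / (\<alpha> * real k + real n)"
      using \<beta> by (simp add: powr_add[symmetric] powr_realpow)
    finally show "((\<lambda>y. y^(n-1) * ((y / \<beta>) powr \<alpha>)^k) has_integral \<beta>^n / (\<alpha> * real k + real n)) {0..\<beta>}"
    proof (rule has_integral_spike_finite[rotated 2])
      fix y assume "y \<in> {0..\<beta>} - {0}"
      then have y: "0 < y" "0 < y / \<beta>" using \<beta> by auto
      have "((y / \<beta>) powr \<alpha>)^k = (y / \<beta>) powr (\<alpha> * real k)"
        by (rule powr_pow[OF y(2)])
      also have "\<dots> = \<beta> powr (- (\<alpha> * real k)) * y powr (\<alpha> * real k)"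
        using y \<beta> by (simp add: powr_divide powr_minus_divide)
      finally show "y^(n-1) * ((y / \<beta>) powr \<alpha>)^k = \<beta> powr (- (\<alpha> * real k)) * (y^(n-1) * y powr (\<alpha> * real k))"
        by simp
    qed auto
  next
    have "continuous_on {0..\<beta>} (\<lambda>y. y^(n-1) / (1 + (y / \<beta>) powr \<alpha>))"
      using \<alpha> \<beta> by (intro continuous_intros continuous_on_powr') (auto simp: add_nonneg_eq_0_iff)
    then show "((\<lambda>y. y^(n-1) / (1 + (y / \<beta>) powr \<alpha>)) has_integral
      integral {0..\<beta>} (\<lambda>y. y^(n-1) / (1 + (y / \<beta>) powr \<alpha>))) {0..\<beta>}"
      by (intro integrable_integral integrable_continuous_real)
  next
    show "(\<lambda>k. \<beta>^n / (\<alpha> * real k + real n)) \<longlonglongrightarrow> 0" using \<alpha> by real_asymp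
  qed (use \<beta> in auto)
  also have "integral {0..\<beta>} (\<lambda>y. y^(n-1) / (1 + (y / \<beta>) powr \<alpha>)) = integral {0..\<beta>} (\<lambda>y. y^(n-1) * (\<beta> powr \<alpha> / (y powr \<alpha> + \<beta> powr \<alpha>)))"
    by (rule integral_cong) (use eq in auto)
  finally show ?thesis .
qed

text \<open>The case distinction is the integral of \<open>y\<^sup>n\<^sup>-\<^sup>1\<^sup>-\<^sup>s\<close> over \<open>[\<beta>,1]\<close>, where \<open>s = \<alpha>k\<close>: for \<open>s = n\<close> the
antiderivative is a logarithm. This is the origin of \<open>ln \<beta>\<close> in the expansion.\<close>

lemma moment_above:
  "(\<lambda>k. (-1)^k * (if \<alpha> * real (Suc k) = real n then - (\<beta>^n) * ln \<beta>
      else (\<beta> powr (\<alpha> * real (Suc k)) - \<beta>^n) / (real n - \<alpha> * real (Suc k)))) sums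
    integral {\<beta>..1} (\<lambda>y. y^(n-1) * (\<beta> powr \<alpha> / (y powr \<alpha> + \<beta> powr \<alpha>)))"
proof -
  let ?c = "\<lambda>k. if \<alpha> * real (Suc k) = real n then - (\<beta>^n) * ln \<beta>
      else (\<beta> powr (\<alpha> * real (Suc k)) - \<beta>^n) / (real n - \<alpha> * real (Suc k))"
  have eq: "y^(n-1) * (\<beta> / y) powr \<alpha> / (1 + (\<beta> / y) powr \<alpha>) = y^(n-1) * (\<beta> powr \<alpha> / (y powr \<alpha> + \<beta> powr \<alpha>))" if "0 < y" for y
  proof -
    have "(\<beta> / y) powr \<alpha> = \<beta> powr \<alpha> / y powr \<alpha>" using that \<beta> by (simp add: powr_divide)
    moreover have "v / u / (1 + v / u) = v / (u + v)" if "0 < u" "0 < v" for u v :: real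
      using that by (simp add: field_simps)
    from this[of "y powr \<alpha>" "\<beta> powr \<alpha>"] \<beta> that
    have "\<beta> powr \<alpha> / y powr \<alpha> / (1 + \<beta> powr \<alpha> / y powr \<alpha>) = \<beta> powr \<alpha> / (y powr \<alpha> + \<beta> powr \<alpha>)" by simp
    ultimately show ?thesis by (metis times_divide_eq_right)
  qed
  have "(\<lambda>k. (-1)^k * ?c k) sums integral {\<beta>..1} (\<lambda>y. y^(n-1) * (\<beta> / y) powr \<alpha> / (1 + (\<beta> / y) powr \<alpha>))"
  proof (rule alternating_geometric_integral)
    fix k
    let ?s = "\<alpha> * real (Suc k)"
    have pw: "\<beta> powr ?s * y powr (real n - 1 - ?s) = y^(n-1) * (\<beta> / y) powr \<alpha> * ((\<beta> / y) powr \<alpha>)^k" if y: "y \<in> {\<beta>..1}" for y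
    proof -
      have "0 < y" and p: "0 < \<beta> / y" using y \<beta> by auto
      from p have 1: "((\<beta> / y) powr \<alpha>)^Suc k = (\<beta> / y) powr ?s"
        by (rule powr_pow)
      have "y^(n-1) = y powr (real n - 1)" using n \<open>0 < y\<close> by (simp add: powr_realpow[symmetric] of_nat_diff)
      then have 2: "y powr (real n - 1 - ?s) = y^(n-1) / y powr ?s"
        using powr_diff[of y "real n - 1" ?s] by metis
      have "\<beta> powr ?s * y powr (real n - 1 - ?s) = y^(n-1) * ((\<beta> / y) powr \<alpha>)^Suc k"
        unfolding 1 2 powr_divide[of \<beta> y ?s] by simp
      then show ?thesis by (simp only: mult.assoc power_Suc)
    qed
    have "((\<lambda>y. \<beta> powr ?s * y powr (real n - 1 - ?s)) has_integral ?c k) {\<beta>..1}"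
    proof (cases "?s = real n")
      case True
      have "((\<lambda>y. \<beta> powr ?s * y powr (real n - 1 - ?s)) has_integral (\<beta>^n * ln 1 - \<beta>^n * ln \<beta>)) {\<beta>..1}"
      proof (rule fundamental_theorem_of_calculus)
        fix y assume y: "y \<in> {\<beta>..1}"
        have "((\<lambda>y. \<beta>^n * ln y) has_real_derivative \<beta>^n * (1 / y)) (at y within {\<beta>..1})"
          using y \<beta> by (auto intro!: derivative_eq_intros)
        also have "\<beta>^n * (1 / y) = \<beta> powr ?s * y powr (real n - 1 - ?s)"
          unfolding True using y \<beta> by (simp add: powr_realpow powr_minus_divide)
        finally show "((\<lambda>y. \<beta>^n * ln y) has_vector_derivative \<beta> powr ?s * y powr (real n - 1 - ?s)) (at y within {\<beta>..1})"
          by (simp only: has_real_derivative_iff_has_vector_derivative)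
      qed (use \<beta> in auto)
      then show ?thesis unfolding if_P[OF True] by simp
    next
      case False
      have "((\<lambda>y. \<beta> powr ?s * y powr (real n - 1 - ?s)) has_integral
        (\<beta> powr ?s * (1 powr (real n - ?s) / (real n - ?s)) - \<beta> powr ?s * (\<beta> powr (real n - ?s) / (real n - ?s)))) {\<beta>..1}"
      proof (rule fundamental_theorem_of_calculus)
        fix y assume y: "y \<in> {\<beta>..1}"
        have "((\<lambda>y. \<beta> powr ?s * (y powr (real n - ?s) / (real n - ?s))) has_real_derivative
           \<beta> powr ?s * ((real n - ?s) * y powr (real n - ?s - 1) / (real n - ?s))) (at y within {\<beta>..1})"
        proof (intro DERIV_cmult DERIV_cdivide)
          have "0 < y" using y \<beta> by simp
          from has_real_derivative_powr[OF this]
          show "((\<lambda>y. y powr (real n - ?s)) has_real_derivative (real n - ?s) * y powr (real n - ?s - 1)) (at y within {\<beta>..1})"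
            by (rule has_field_derivative_at_within)
        qed
        also have "\<beta> powr ?s * ((real n - ?s) * y powr (real n - ?s - 1) / (real n - ?s)) = \<beta> powr ?s * y powr (real n - 1 - ?s)"
        proof -
          have e: "real n - ?s - 1 = real n - 1 - ?s" by simp
          have nz: "real n - ?s \<noteq> 0" using False by simp
          show ?thesis unfolding e nonzero_mult_div_cancel_left[OF nz] ..
        qed
        finally show "((\<lambda>y. \<beta> powr ?s * (y powr (real n - ?s) / (real n - ?s))) has_vector_derivative \<beta> powr ?s * y powr (real n - 1 - ?s)) (at y within {\<beta>..1})"
          by (simp only: has_real_derivative_iff_has_vector_derivative)
      qed (use \<beta> in auto)
      moreover have "\<beta> powr ?s * (1 powr (real n - ?s) / (real n - ?s)) - \<beta> powr ?s * (\<beta> powr (real n - ?s) / (real n - ?s))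
          = (\<beta> powr ?s - \<beta>^n) / (real n - ?s)"
      proof -
        have "?s + (real n - ?s) = real n" by simp
        then have "\<beta> powr ?s * \<beta> powr (real n - ?s) = \<beta>^n"
          using \<beta> by (simp only: powr_add[symmetric] powr_realpow)
        then show ?thesis by (simp only: times_divide_eq_right powr_one_eq_one mult_1_right diff_divide_distrib)
      qed
      ultimately show ?thesis unfolding if_not_P[OF False] by (simp only:)
    qed
    then show "((\<lambda>y. y^(n-1) * (\<beta> / y) powr \<alpha> * ((\<beta> / y) powr \<alpha>)^k) has_integral ?c k) {\<beta>..1}"
      by (rule has_integral_eq[rotated]) (rule pw)
  next
    have "continuous_on {\<beta>..1} (\<lambda>y. y^(n-1) * (\<beta> / y) powr \<alpha> / (1 + (\<beta> / y) powr \<alpha>))"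
      using \<alpha> \<beta> by (intro continuous_intros continuous_on_powr') (auto simp: add_nonneg_eq_0_iff)
    then show "((\<lambda>y. y^(n-1) * (\<beta> / y) powr \<alpha> / (1 + (\<beta> / y) powr \<alpha>)) has_integral
      integral {\<beta>..1} (\<lambda>y. y^(n-1) * (\<beta> / y) powr \<alpha> / (1 + (\<beta> / y) powr \<alpha>))) {\<beta>..1}"
      by (intro integrable_integral integrable_continuous_real)
  next
    have "(\<lambda>k. 1 / \<bar>real n - \<alpha> * real (Suc k)\<bar>) \<longlonglongrightarrow> 0" using \<alpha> by real_asymp
    then show "?c \<longlonglongrightarrow> 0"
    proof (rule Lim_null_comparison[rotated])
      have "eventually (\<lambda>k. real n < \<alpha> * real (Suc k)) at_top" using \<alpha> by real_asymp
      then show "\<forall>\<^sub>F k in sequentially. norm (?c k) \<le> 1 / \<bar>real n - \<alpha> * real (Suc k)\<bar>"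
      proof eventually_elim
        case (elim k)
        have "\<beta> powr (\<alpha> * real (Suc k)) \<le> 1" "0 \<le> \<beta> powr (\<alpha> * real (Suc k))" using \<alpha> \<beta> by (auto intro!: powr_le1)
        moreover have "\<beta>^n \<le> 1" "0 \<le> \<beta>^n" using \<beta> by (auto intro: power_le_one)
        ultimately have "\<bar>\<beta> powr (\<alpha> * real (Suc k)) - \<beta>^n\<bar> \<le> 1" by linarith
        then show ?case using elim by (simp add: divide_right_mono del: of_nat_Suc)
      qed
    qed
  qed (use \<beta> in auto)
  also have "integral {\<beta>..1} (\<lambda>y. y^(n-1) * (\<beta> / y) powr \<alpha> / (1 + (\<beta> / y) powr \<alpha>)) = integral {\<beta>..1} (\<lambda>y. y^(n-1) * (\<beta> powr \<alpha> / (y powr \<alpha> + \<beta> powr \<alpha>)))"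
    by (rule integral_cong) (use eq \<beta> in auto)
  finally show ?thesis .
qed

end

text \<open>The coefficient of \<open>\<beta>\<^sup>n\<close> in the \<open>n\<close>-th moment of the folded profile.\<close>

definition moment_coeff :: "real \<Rightarrow> real \<Rightarrow> nat \<Rightarrow> real" where
  "moment_coeff \<alpha> \<beta> n = (if real n / \<alpha> \<in> \<nat> then (-1) ^ nat \<lfloor>real n / \<alpha>\<rfloor> * ln \<beta>
     else pi / (\<alpha> * sin (real n * pi / \<alpha>)))"

text \<open>With \<open>b = n/\<alpha>\<close> the \<open>k\<close>-th term is \<open>2b/\<alpha>\<close> times a term of the pole series at \<open>b\<close>. If \<open>b\<close> is an integer, that
series lacks its term at \<open>b\<close>, whereas \<open>1/(\<alpha>k + n)\<close> survives there and contributes \<open>1/(2n)\<close> up to sign.\<close>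

lemma sums_pole_differences:
  assumes \<alpha>: "0 < \<alpha>" and n: "n \<ge> 1"
  shows "(\<lambda>k. (-1)^k * (1 / (\<alpha> * real (Suc k) + real n) + 1 / (real n - \<alpha> * real (Suc k)))) sums
    (1 / real n - (if real n / \<alpha> \<in> \<nat> then 0 else pi / (\<alpha> * sin (real n * pi / \<alpha>))))"
proof -
  define b where "b = real n / \<alpha>"
  have b: "0 < b" "real n = \<alpha> * b" using \<alpha> n by (auto simp: b_def)
  define t where "t = (\<lambda>m. (real m)\<^sup>2 * pole_coeff b m)"
  have "summable t"
    by (rule summable_comparison_test'[OF summable_pole_coeff[of b]]) (simp add: t_def abs_mult)
  then have "t sums suminf t" by (rule summable_sums)
  moreover have "t 0 = 0" by (simp add: t_def)
  ultimately have "(\<lambda>k. t (Suc k)) sums suminf t" by (simp add: sums_Suc_iff)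
  then have t: "(\<lambda>k. 2 * b / \<alpha> * t (Suc k)) sums (2 * b / \<alpha> * suminf t)" by (rule sums_mult)
  have tk: "(-1)^k * (1 / (\<alpha> * real (Suc k) + real n) + 1 / (real n - \<alpha> * real (Suc k))) = 2 * b / \<alpha> * t (Suc k)"
    if "real (Suc k) \<noteq> b" for k
  proof -
    define m where "m = real (Suc k)"
    have m: "0 < m" "m \<noteq> b" using that by (auto simp: m_def)
    have p: "m\<^sup>2 - b\<^sup>2 = - ((b - m) * (b + m))" by (simp add: power2_eq_square algebra_simps)
    have "1 / (\<alpha> * m + \<alpha> * b) + 1 / (\<alpha> * b - \<alpha> * m) = (1 / (b + m) + 1 / (b - m)) / \<alpha>"
      using \<alpha> by (simp add: distrib_left[symmetric] right_diff_distrib[symmetric] add_divide_distrib add.commute mult.commute)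
    also have "1 / (b + m) + 1 / (b - m) = 2 * b / ((b - m) * (b + m))"
      using m b by (simp add: field_simps)
    finally have "1 / (\<alpha> * m + \<alpha> * b) + 1 / (\<alpha> * b - \<alpha> * m) = - (2 * b / \<alpha> * (1 / (m\<^sup>2 - b\<^sup>2)))"
      unfolding p by simp
    moreover have "t (Suc k) = - ((-1)^k * (1 / (m\<^sup>2 - b\<^sup>2)))"
      using m by (simp add: t_def pole_coeff_def m_def del: of_nat_Suc)
    ultimately show ?thesis unfolding b(2) by (simp add: m_def del: of_nat_Suc)
  qed
  show ?thesis
  proof (cases "b \<in> \<nat>")
    case False
    then have nb: "real (Suc k) \<noteq> b" for k by (metis of_nat_in_Nats)
    then have "(\<lambda>k. (-1)^k * (1 / (\<alpha> * real (Suc k) + real n) + 1 / (real n - \<alpha> * real (Suc k)))) sums (2 * b / \<alpha> * suminf t)"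
      using t by (simp only: tk[OF nb])
    also have "suminf t = 1 / (2 * b\<^sup>2) - pi / (2 * b * sin (b * pi))"
      unfolding t_def by (rule pole_sum_noninteger[OF b(1) False])
    also have "2 * b / \<alpha> * (1 / (2 * b\<^sup>2) - pi / (2 * b * sin (b * pi))) = 1 / (\<alpha> * b) - pi / (\<alpha> * sin (b * pi))"
      using b \<alpha> by (simp add: right_diff_distrib power2_eq_square)
    also have "1 / (\<alpha> * b) - pi / (\<alpha> * sin (b * pi)) = 1 / real n - (if real n / \<alpha> \<in> \<nat> then 0 else pi / (\<alpha> * sin (real n * pi / \<alpha>)))"
      using False \<alpha> by (simp add: b_def)
    finally show ?thesis .
  next
    case True
    then obtain i where "b = real i" by (auto elim: Nats_cases)
    then obtain l where l: "b = real (Suc l)" using b by (cases i) auto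
    define r where "r = (-1)^l / (2 * real n)"
    have "(\<lambda>k. 2 * b / \<alpha> * t (Suc k) + (if k = l then r else 0)) sums (2 * b / \<alpha> * suminf t + r)"
      by (intro sums_add t sums_single[of l "\<lambda>_. r"])
    also have "(\<lambda>k. 2 * b / \<alpha> * t (Suc k) + (if k = l then r else 0)) =
        (\<lambda>k. (-1)^k * (1 / (\<alpha> * real (Suc k) + real n) + 1 / (real n - \<alpha> * real (Suc k))))"
    proof
      fix k
      show "2 * b / \<alpha> * t (Suc k) + (if k = l then r else 0) =
          (-1)^k * (1 / (\<alpha> * real (Suc k) + real n) + 1 / (real n - \<alpha> * real (Suc k)))"
      proof (cases "k = l")
        case True
        then have "real n = \<alpha> * real (Suc l)" using b l by simp
        moreover have "t (Suc k) = 0" using True l by (simp add: t_def pole_coeff_def)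
        ultimately show ?thesis unfolding if_P[OF True] r_def True by simp
      next
        case False
        then have "real (Suc k) \<noteq> b" using l by simp
        from tk[OF this] show ?thesis unfolding if_not_P[OF False] by simp
      qed
    qed
    also have "suminf t = 1 / (2 * b\<^sup>2) + (-1)^Suc l / (4 * b\<^sup>2)"
      unfolding t_def l by (rule pole_sum_integer) simp
    also have "2 * b / \<alpha> * (1 / (2 * b\<^sup>2) + (-1)^Suc l / (4 * b\<^sup>2)) + r = 1 / real n"
      using b \<alpha> by (simp add: r_def field_simps power2_eq_square)
    finally show ?thesis using True by (simp add: b_def)
  qed
qed

text \<open>Adding the three partial expansions, the powers \<open>\<beta>\<^sup>\<alpha>\<^sup>k\<close> collect the pole differences; the multiples of
\<open>\<beta>\<^sup>n\<close> sum to \<open>moment_coeff\<close> by \<open>sums_pole_differences\<close> and, in the resonant case, the single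
logarithmic term.\<close>

lemma moment_expansion:
  assumes \<alpha>: "0 < \<alpha>" and \<beta>: "0 < \<beta>" "\<beta> < 1" and n: "n \<ge> 1"
  shows "(\<lambda>k. (-1)^k * \<beta> powr (\<alpha> * real (Suc k)) *
      (1 / (\<alpha> * real (Suc k) + real n) + 1 / (real n - \<alpha> * real (Suc k)))) sums
    (integral {0..1} (\<lambda>y. y^(n-1) * folded_profile \<alpha> \<beta> y) - \<beta>^n * moment_coeff \<alpha> \<beta> n)"
proof -
  let ?s = "\<lambda>k. \<alpha> * real (Suc k)"
  let ?f1 = "\<lambda>y. y^(n-1) * ((\<beta> * y) powr \<alpha> / (1 + (\<beta> * y) powr \<alpha>))"
  let ?f2 = "\<lambda>y. y^(n-1) * (\<beta> powr \<alpha> / (y powr \<alpha> + \<beta> powr \<alpha>))"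
  have c1: "continuous_on {0..1} ?f1" and c2: "continuous_on {0..1} ?f2"
    using \<alpha> \<beta> by (auto intro!: continuous_intros continuous_on_powr' simp: add_nonneg_eq_0_iff)
  have "integral {0..1} (\<lambda>y. y^(n-1) * folded_profile \<alpha> \<beta> y) = integral {0..1} (\<lambda>y. ?f1 y + ?f2 y)"
    by (simp add: folded_profile_def distrib_left)
  also have "\<dots> = integral {0..1} ?f1 + integral {0..1} ?f2"
    by (intro integral_add integrable_continuous_real c1 c2)
  also have "integral {0..1} ?f2 = integral {0..\<beta>} ?f2 + integral {\<beta>..1} ?f2"
    using \<beta> by (intro Henstock_Kurzweil_Integration.integral_combine[symmetric] integrable_continuous_real c2) auto
  finally have J: "integral {0..1} (\<lambda>y. y^(n-1) * folded_profile \<alpha> \<beta> y) =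
      integral {0..1} ?f1 + (integral {0..\<beta>} ?f2 + integral {\<beta>..1} ?f2)" .
  \<comment> \<open>The term \<open>\<beta>\<^sup>n/n\<close> at \<open>k = 0\<close> is split off, so that all series run over the exponents \<open>\<alpha>, 2\<alpha>, \<dots>\<close>.\<close>
  have s2: "(\<lambda>k. (-1)^Suc k * (\<beta>^n / (\<alpha> * real (Suc k) + real n))) sums (integral {0..\<beta>} ?f2 - \<beta>^n / real n)"
    using moment_below[OF \<alpha> \<beta> n] by (subst sums_Suc_iff) simp
  have s4: "(\<lambda>k. \<beta>^n * ((-1)^k * (1 / (?s k + real n) + 1 / (real n - ?s k)))) sums
      (\<beta>^n * (1 / real n - (if real n / \<alpha> \<in> \<nat> then 0 else pi / (\<alpha> * sin (real n * pi / \<alpha>)))))"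
    by (intro sums_mult sums_pole_differences \<alpha> n)
  \<comment> \<open>The logarithmic term, to be taken away from the third expansion and accounted for separately.\<close>
  have s5: "(\<lambda>k. if ?s k = real n then (-1)^k * (\<beta>^n * ln \<beta>) else 0) sums
      (if real n / \<alpha> \<in> \<nat> then - (\<beta>^n * ((-1) ^ nat \<lfloor>real n / \<alpha>\<rfloor> * ln \<beta>)) else 0)"
  proof (cases "real n / \<alpha> \<in> \<nat>")
    case True
    then obtain i where i: "real n / \<alpha> = real i" by (auto elim: Nats_cases)
    moreover have "0 < real n / \<alpha>" using n \<alpha> by simp
    ultimately obtain l where l: "real n / \<alpha> = real (Suc l)" by (cases i) auto
    then have eq: "?s k = real n \<longleftrightarrow> k = l" for k using \<alpha> by (simp add: field_simps)
    have "nat \<lfloor>real n / \<alpha>\<rfloor> = Suc l" unfolding l by simp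
    then have v: "(if real n / \<alpha> \<in> \<nat> then - (\<beta>^n * ((-1) ^ nat \<lfloor>real n / \<alpha>\<rfloor> * ln \<beta>)) else 0) = (-1)^l * (\<beta>^n * ln \<beta>)"
      using True by simp
    show ?thesis unfolding eq v by (rule sums_single)
  next
    case False
    have "?s k \<noteq> real n" for k
    proof
      assume "?s k = real n"
      then have "real n / \<alpha> = real (Suc k)" using \<alpha> by (simp add: field_simps)
      then show False using False by (metis of_nat_in_Nats)
    qed
    then show ?thesis using False by simp
  qed
  have eq: "(-1)^k * (\<beta> powr ?s k / (?s k + real n)) + (-1)^Suc k * (\<beta>^n / (?s k + real n))
    + (-1)^k * (if ?s k = real n then - (\<beta>^n) * ln \<beta> else (\<beta> powr ?s k - \<beta>^n) / (real n - ?s k))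
    + \<beta>^n * ((-1)^k * (1 / (?s k + real n) + 1 / (real n - ?s k)))
    + (if ?s k = real n then (-1)^k * (\<beta>^n * ln \<beta>) else 0)
    = (-1)^k * \<beta> powr ?s k * (1 / (?s k + real n) + 1 / (real n - ?s k))" for k
  proof (cases "?s k = real n")
    case True
    have "\<beta> powr ?s k = \<beta>^n" unfolding True using \<beta> by (simp add: powr_realpow)
    then show ?thesis unfolding if_P[OF True] True by (simp add: algebra_simps)
  next
    case False
    have "e * (B / (s + m)) + - e * (C / (s + m)) + e * ((B - C) / (m - s)) + C * (e * (1 / (s + m) + 1 / (m - s))) + 0
        = e * B * (1 / (s + m) + 1 / (m - s))" for e B C s m :: real
      by (simp add: algebra_simps diff_divide_distrib)
    from this[of "(-1)^k" "\<beta> powr ?s k" "?s k" "real n" "\<beta>^n"]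
    show ?thesis unfolding if_not_P[OF False] power_Suc by simp
  qed
  have "(\<lambda>k. (-1)^k * \<beta> powr ?s k * (1 / (?s k + real n) + 1 / (real n - ?s k))) sums
      (integral {0..1} ?f1 + (integral {0..\<beta>} ?f2 - \<beta>^n / real n) + integral {\<beta>..1} ?f2
      + \<beta>^n * (1 / real n - (if real n / \<alpha> \<in> \<nat> then 0 else pi / (\<alpha> * sin (real n * pi / \<alpha>))))
      + (if real n / \<alpha> \<in> \<nat> then - (\<beta>^n * ((-1) ^ nat \<lfloor>real n / \<alpha>\<rfloor> * ln \<beta>)) else 0))"
    using sums_add[OF sums_add[OF sums_add[OF sums_add[OF moment_inner[OF \<alpha> \<beta> n] s2] moment_above[OF \<alpha> \<beta> n]] s4] s5]
    unfolding eq .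
  also have "(integral {0..1} ?f1 + (integral {0..\<beta>} ?f2 - \<beta>^n / real n) + integral {\<beta>..1} ?f2
      + \<beta>^n * (1 / real n - (if real n / \<alpha> \<in> \<nat> then 0 else pi / (\<alpha> * sin (real n * pi / \<alpha>))))
      + (if real n / \<alpha> \<in> \<nat> then - (\<beta>^n * ((-1) ^ nat \<lfloor>real n / \<alpha>\<rfloor> * ln \<beta>)) else 0))
      = integral {0..1} (\<lambda>y. y^(n-1) * folded_profile \<alpha> \<beta> y) - \<beta>^n * moment_coeff \<alpha> \<beta> n"
    unfolding J moment_coeff_def by (cases "real n / \<alpha> \<in> \<nat>") (simp_all only: if_True if_False right_diff_distrib, simp_all)
  finally show ?thesis .
qed

section \<open>Collecting the coefficients of the powers\<close>

lemma rational_separation: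
  assumes "\<alpha> \<in> \<rat>" "0 < \<alpha>"
  obtains Q :: real where "1 \<le> Q" "\<And>k n. \<alpha> * real k \<noteq> real n \<Longrightarrow> 1 / Q \<le> \<bar>real n - \<alpha> * real k\<bar>"
proof -
  obtain p q :: nat where q: "q \<noteq> 0" and "\<bar>\<alpha>\<bar> = real p / real q"
    using Rats_abs_nat_div_natE[OF assms(1)] by metis
  then have \<alpha>: "\<alpha> = real p / real q" using assms by simp
  show ?thesis
  proof (rule that[of "real q"])
    fix k n assume ne: "\<alpha> * real k \<noteq> real n"
    have e: "real n - \<alpha> * real k = of_int (int q * int n - int p * int k) / real q"
      using q by (simp add: \<alpha> field_simps)
    then have "int q * int n - int p * int k \<noteq> 0" using ne by (metis div_0 eq_iff_diff_eq_0 of_int_0)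
    then have "1 \<le> \<bar>int q * int n - int p * int k\<bar>" by linarith
    then have "1 \<le> \<bar>real_of_int (int q * int n - int p * int k)\<bar>" by linarith
    then show "1 / real q \<le> \<bar>real n - \<alpha> * real k\<bar>"
      unfolding e abs_divide using q by (simp add: divide_right_mono)
  qed (use q in simp)
qed

text \<open>Modulo \<open>\<pi>\<close> only the finitely many angles \<open>i\<pi>/q\<close> occur.\<close>

lemma sin_rational_lower_bound:
  fixes q :: nat
  assumes q: "q \<noteq> 0"
  obtains c :: real where "0 < c" "\<And>x. real q * x \<in> \<int> \<Longrightarrow> x \<notin> \<int> \<Longrightarrow> c \<le> \<bar>sin (x * pi)\<bar>"
proof -
  define S where "S = (\<lambda>i. \<bar>sin (real i / real q * pi)\<bar>) ` {1..<q}"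
  have pos: "0 < y" if yS: "y \<in> S" for y
  proof -
    obtain i where i: "i \<in> {1..<q}" and y: "y = \<bar>sin (real i / real q * pi)\<bar>" using yS unfolding S_def by blast
    have "0 < sin (real i / real q * pi)" using i by (intro sin_gt_zero) (auto simp: field_simps)
    then show ?thesis using y by simp
  qed
  show ?thesis
  proof (rule that[of "Min (insert 1 S)"])
    show "0 < Min (insert 1 S)" using pos by (simp add: S_def)
    fix x :: real assume x: "real q * x \<in> \<int>" "x \<notin> \<int>"
    obtain z where "real q * x = of_int z" using x(1) by (auto elim: Ints_cases)
    then have xz: "x = of_int z / real q" using q by (simp add: field_simps)
    define i where "i = nat (z mod int q)"
    have i: "real i = of_int (z mod int q)" using q by (simp add: i_def)
    have "of_int z = of_int (z div int q) * real q + real i"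
      unfolding i by (metis of_int_add of_int_mult of_int_of_nat_eq div_mult_mod_eq)
    then have d: "x = real i / real q + of_int (z div int q)" unfolding xz using q by (simp add: field_simps)
    have "i \<noteq> 0"
    proof
      assume "i = 0"
      then show False using d x(2) by simp
    qed
    moreover have "i < q" using q by (simp add: i_def nat_less_iff)
    ultimately have "\<bar>sin (real i / real q * pi)\<bar> \<in> insert 1 S" by (auto simp: S_def)
    then have "Min (insert 1 S) \<le> \<bar>sin (real i / real q * pi)\<bar>" by (intro Min_le) (auto simp: S_def)
    also have "\<dots> = \<bar>sin (x * pi)\<bar>"
    proof -
      have "sin (x * pi) = sin (real i / real q * pi) * cos (of_int (z div int q) * pi)"
        unfolding d distrib_right sin_add by (simp add: mult.commute[of _ pi])
      moreover have "\<bar>cos (of_int (z div int q) * pi)\<bar> = 1"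
        using sin_cos_squared_add[of "of_int (z div int q) * pi"]
        by (simp add: mult.commute[of _ pi] abs_square_eq_1)
      ultimately show ?thesis by (simp add: abs_mult)
    qed
    finally show "Min (insert 1 S) \<le> \<bar>sin (x * pi)\<bar>" .
  qed
qed

text \<open>The value of the sine series in \<open>sine_expansion\<close>, up to the additive constant \<open>\<theta>\<close>.\<close>

definition sine_coeff :: "real \<Rightarrow> real \<Rightarrow> real" where
  "sine_coeff \<theta> s = (if s \<in> \<nat> then (-1) ^ nat \<lfloor>s\<rfloor> * \<theta> * cos (s * \<theta>) else pi * sin (s * \<theta>) / sin (s * pi))"

text \<open>Up to sign, the \<open>j\<close>-th term is \<open>2s\<^sup>2\<close> times a term of \<open>pole_sine_series\<close> at \<open>s\<close>. The summand \<open>2/n\<close> subtracted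
from the pole differences makes the series absolutely convergent, at the price of the constant
\<open>-\<theta>\<close>. For integral \<open>s\<close> the term \<open>n = s\<close>, absent from the pole series, cancels the multiple of \<open>sin(s\<theta>)\<close>
in \<open>pole_sine_integer\<close>.\<close>

lemma sine_expansion:
  assumes s: "0 < s" and \<theta>: "0 \<le> \<theta>" "\<theta> \<le> pi"
  shows "(\<lambda>j. (-1)^j * sin (real (Suc j) * \<theta>) * (1 / (s + real (Suc j)) + 1 / (real (Suc j) - s) - 2 / real (Suc j)))
    sums (sine_coeff \<theta> s - \<theta>)"
proof -
  let ?e = "\<lambda>m. 1 / (s + real m) + 1 / (real m - s) - 2 / real m"
  define t where "t = (\<lambda>m. real m * pole_coeff s m * sin (real m * \<theta>))"
  have "summable t"
  proof (rule summable_comparison_test'[OF summable_pole_coeff[of s]])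
    fix m
    have "norm (t m) \<le> real m * \<bar>pole_coeff s m\<bar>" by (simp add: t_def abs_mult mult_left_le)
    also have "\<dots> \<le> (real m)\<^sup>2 * \<bar>pole_coeff s m\<bar>"
      by (intro mult_right_mono) (cases m, auto simp: power2_eq_square)
    finally show "norm (t m) \<le> (real m)\<^sup>2 * \<bar>pole_coeff s m\<bar>" .
  qed
  then have "t sums suminf t" by (rule summable_sums)
  moreover have "t 0 = 0" by (simp add: t_def)
  ultimately have "(\<lambda>k. t (Suc k)) sums suminf t" by (simp add: sums_Suc_iff)
  then have t: "(\<lambda>k. - 2 * s\<^sup>2 * t (Suc k)) sums (- 2 * s\<^sup>2 * suminf t)" by (rule sums_mult)
  have tk: "(-1)^k * sin (real (Suc k) * \<theta>) * ?e (Suc k) = - 2 * s\<^sup>2 * t (Suc k)" if "real (Suc k) \<noteq> s" for k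
  proof -
    define m where "m = real (Suc k)"
    have m: "0 < m" "m \<noteq> s" "m\<^sup>2 - s\<^sup>2 \<noteq> 0" using that s by (auto simp: m_def power2_eq_iff)
    have p: "m\<^sup>2 - s\<^sup>2 = (m - s) * (s + m)" by (simp add: power2_eq_square algebra_simps)
    have "1 / (s + m) + 1 / (m - s) - 2 / m = 2 * s\<^sup>2 / (m * (m\<^sup>2 - s\<^sup>2))"
      unfolding p using m s by (simp add: divide_simps) (simp add: algebra_simps power2_eq_square)
    moreover have "t (Suc k) = - ((-1)^k * sin (m * \<theta>) / (m * (m\<^sup>2 - s\<^sup>2)))"
      using m by (simp add: t_def pole_coeff_def m_def[symmetric] power2_eq_square del: of_nat_Suc)
    ultimately show ?thesis unfolding m_def[symmetric] by simp
  qed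
  show ?thesis
  proof (cases "s \<in> \<nat>")
    case False
    then have ns: "real (Suc k) \<noteq> s" for k by (metis of_nat_in_Nats)
    have "suminf t = \<theta> / (2 * s\<^sup>2) - pi * sin (s * \<theta>) / (2 * s\<^sup>2 * sin (s * pi))"
      unfolding t_def by (rule pole_sine_noninteger[OF s False \<theta>])
    then have "- 2 * s\<^sup>2 * suminf t = sine_coeff \<theta> s - \<theta>"
      using s False by (simp add: sine_coeff_def right_diff_distrib)
    then show ?thesis using t unfolding tk[OF ns] by simp
  next
    case True
    then obtain i where "s = real i" by (auto elim: Nats_cases)
    then obtain l where l: "s = real (Suc l)" using s by (cases i) auto
    define r where "r = - ((-1)^l * 3 / (2 * s) * sin (s * \<theta>))"
    have "(\<lambda>k. - 2 * s\<^sup>2 * t (Suc k) + (if k = l then r else 0)) sums (- 2 * s\<^sup>2 * suminf t + r)"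
      by (intro sums_add t sums_single[of l "\<lambda>_. r"])
    also have "(\<lambda>k. - 2 * s\<^sup>2 * t (Suc k) + (if k = l then r else 0)) =
        (\<lambda>k. (-1)^k * sin (real (Suc k) * \<theta>) * ?e (Suc k))"
    proof
      fix k
      show "- 2 * s\<^sup>2 * t (Suc k) + (if k = l then r else 0) = (-1)^k * sin (real (Suc k) * \<theta>) * ?e (Suc k)"
      proof (cases "k = l")
        case True
        have z: "t (Suc l) = 0" by (simp add: t_def pole_coeff_def l)
        have "?e (Suc l) = - (3 / (2 * s))" using s unfolding l[symmetric] by (simp add: field_simps)
        then show ?thesis unfolding if_P[OF True] True z r_def l[symmetric] by simp
      next
        case False
        then have "real (Suc k) \<noteq> s" using l by simp
        from tk[OF this] show ?thesis unfolding if_not_P[OF False] by simp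
      qed
    qed
    also have "suminf t = \<theta> / (2 * s\<^sup>2) - (-1)^Suc l * \<theta> * cos (s * \<theta>) / (2 * s\<^sup>2) + 3 * (-1)^Suc l * sin (s * \<theta>) / (4 * s ^ 3)"
      unfolding t_def l by (rule pole_sine_integer[OF _ \<theta>]) simp
    also have "- 2 * s\<^sup>2 * (\<theta> / (2 * s\<^sup>2) - (-1)^Suc l * \<theta> * cos (s * \<theta>) / (2 * s\<^sup>2) + 3 * (-1)^Suc l * sin (s * \<theta>) / (4 * s ^ 3)) + r
        = (-1)^Suc l * \<theta> * cos (s * \<theta>) - \<theta>"
      using s by (simp add: r_def field_simps power2_eq_square power3_eq_cube)
    also have "(-1)^Suc l * \<theta> * cos (s * \<theta>) = sine_coeff \<theta> s"
      using True by (simp add: sine_coeff_def l nat_add_distrib del: of_nat_Suc)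
    finally show ?thesis .
  qed
qed

text \<open>Off resonance the left-hand side is \<open>2s\<^sup>2 / (m \<bar>m - s\<bar> (m + s))\<close>.\<close>

lemma pole_difference_bound:
  fixes m s Q :: real
  assumes m: "1 \<le> m" and s: "0 < s" and Q: "1 \<le> Q" and sep: "m \<noteq> s \<Longrightarrow> 1 / Q \<le> \<bar>m - s\<bar>"
  shows "\<bar>1 / (s + m) + 1 / (m - s) - 2 / m\<bar> \<le> 2 * s\<^sup>2 * Q * (1 / m\<^sup>2)"
proof (cases "m = s")
  case True
  have "1 / (s + m) + 1 / (m - s) - 2 / m = - (3 / (2 * s))" using s True by (simp add: field_simps)
  then have "\<bar>1 / (s + m) + 1 / (m - s) - 2 / m\<bar> = 3 / (2 * s)" using s by simp
  also have "\<dots> \<le> 3 / 2 " using s m True by (simp add: field_simps)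
  also have "\<dots> \<le> 2 * s\<^sup>2 * Q * (1 / m\<^sup>2)" using Q True m by simp
  finally show ?thesis .
next
  case False
  have p: "m\<^sup>2 - s\<^sup>2 = (m - s) * (s + m)" by (simp add: power2_eq_square algebra_simps)
  have "1 / (s + m) + 1 / (m - s) - 2 / m = 2 * s\<^sup>2 / (m * (m - s) * (s + m))"
    using m s False by (simp add: divide_simps) (simp add: algebra_simps power2_eq_square)
  then have "\<bar>1 / (s + m) + 1 / (m - s) - 2 / m\<bar> = 2 * s\<^sup>2 * (1 / \<bar>m - s\<bar>) * (1 / (m * (s + m)))"
    using m s by (simp add: abs_mult)
  also have "\<dots> \<le> 2 * s\<^sup>2 * Q * (1 / m\<^sup>2)"
  proof (intro mult_mono)
    have "0 < 1 / Q" using Q by simp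
    then have "1 / \<bar>m - s\<bar> \<le> 1 / (1 / Q)" using sep[OF False] Q False by (intro divide_left_mono) auto
    then show "1 / \<bar>m - s\<bar> \<le> Q" by simp
    show "1 / (m * (s + m)) \<le> 1 / m\<^sup>2" using m s by (intro divide_left_mono) (auto simp: power2_eq_square intro!: mult_left_mono)
  qed (use m s Q in auto)
  finally show ?thesis .
qed

lemma sums_alternating_powr:
  assumes "0 < \<alpha>" "0 < \<beta>" "\<beta> < 1"
  shows "(\<lambda>k. (-1)^k * \<beta> powr (\<alpha> * real (Suc k))) sums (\<beta> powr \<alpha> / (1 + \<beta> powr \<alpha>))"
proof -
  have r: "0 < \<beta> powr \<alpha>" "\<beta> powr \<alpha> < 1" using assms powr_less_mono2[of \<alpha> \<beta> 1] by auto
  have "(\<lambda>k. \<beta> powr \<alpha> * (- (\<beta> powr \<alpha>))^k) sums (\<beta> powr \<alpha> * (1 / (1 - - (\<beta> powr \<alpha>))))"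
    using r by (intro sums_mult geometric_sums) auto
  moreover have "\<beta> powr \<alpha> * (- (\<beta> powr \<alpha>))^k = (-1)^k * \<beta> powr (\<alpha> * real (Suc k))" for k
    using powr_pow[OF assms(2), of \<alpha> "Suc k"] by (simp add: power_minus[of "\<beta> powr \<alpha>"])
  ultimately show ?thesis by simp
qed

lemma summable_sq_powr:
  assumes "0 < \<alpha>" "0 < \<beta>" "\<beta> < 1"
  shows "summable (\<lambda>k. \<beta> powr (\<alpha> * real (Suc k)) * (\<alpha> * real (Suc k))\<^sup>2)"
proof -
  define d where "d = - (\<alpha> * ln \<beta>)"
  have d: "0 < d" using assms by (simp add: d_def mult_pos_neg)
  have "(\<lambda>k. exp (- (d * real (Suc k))) * (\<alpha> * real (Suc k))\<^sup>2) \<in> O(\<lambda>k. 1 / (real k)\<^sup>2)"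
    using d assms(1) by real_asymp
  moreover have "exp (- (d * real (Suc k))) = \<beta> powr (\<alpha> * real (Suc k))" for k
    using assms by (simp add: powr_def d_def mult_ac)
  ultimately have "(\<lambda>k. \<beta> powr (\<alpha> * real (Suc k)) * (\<alpha> * real (Suc k))\<^sup>2) \<in> O(\<lambda>k. 1 / (real k)\<^sup>2)" by simp
  moreover have "summable (\<lambda>m. norm (1 / (real m)\<^sup>2))"
    using inverse_power_summable[of 2, where ?'a=real] by (simp add: field_simps)
  ultimately show ?thesis by (rule summable_comparison_test_bigo[rotated])
qed

text \<open>The double series \<open>f k j\<close>, with \<open>n = j + 1\<close>, is dominated by a product of summable sequences and can be
summed in either order. Summing over \<open>j\<close> first gives \<open>Y - \<Phi>\<theta>\<close> by \<open>sine_expansion\<close>; summing over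
\<open>k\<close> first gives the integral minus \<open>X\<close> minus \<open>2\<Phi>\<close> times the sawtooth series \<open>\<theta>/2\<close>.\<close>

lemma poisson_integral_folded_profile:
  assumes \<alpha>: "\<alpha> \<in> \<rat>" "0 < \<alpha>" and \<beta>: "0 < \<beta>" "\<beta> < 1" and \<theta>: "0 < \<theta>" "\<theta> < pi"
    and X: "(\<lambda>j. (-1)^j * sin (real (Suc j) * \<theta>) * (\<beta>^Suc j * moment_coeff \<alpha> \<beta> (Suc j))) sums X"
    and Y: "(\<lambda>k. (-1)^k * \<beta> powr (\<alpha> * real (Suc k)) * sine_coeff \<theta> (\<alpha> * real (Suc k))) sums Y"
  shows "integral {0..1} (\<lambda>y. poisson_kernel \<theta> y * folded_profile \<alpha> \<beta> y) = X + Y"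
proof -
  let ?s = "\<lambda>k. \<alpha> * real (Suc k)"
  let ?e = "\<lambda>k j. 1 / (?s k + real (Suc j)) + 1 / (real (Suc j) - ?s k) - 2 / real (Suc j)"
  let ?J = "\<lambda>j. integral {0..1} (\<lambda>y. y^j * folded_profile \<alpha> \<beta> y)"
  define IK where "IK = integral {0..1} (\<lambda>y. poisson_kernel \<theta> y * folded_profile \<alpha> \<beta> y)"
  define \<Phi> where "\<Phi> = \<beta> powr \<alpha> / (1 + \<beta> powr \<alpha>)"
  define f where "f = (\<lambda>k j. (-1)^k * \<beta> powr ?s k * ((-1)^j * sin (real (Suc j) * \<theta>) * ?e k j))"
  obtain Q where Q: "1 \<le> Q" and sep: "\<And>k n. \<alpha> * real k \<noteq> real n \<Longrightarrow> 1 / Q \<le> \<bar>real n - \<alpha> * real k\<bar>"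
    using rational_separation[OF \<alpha>] by blast
  define a where "a = (\<lambda>k. \<beta> powr ?s k * (?s k)\<^sup>2 * (2 * Q))"
  define b where "b = (\<lambda>j. 1 / (real (Suc j))\<^sup>2)"
  have sa: "summable a" unfolding a_def by (intro summable_mult2 summable_sq_powr \<alpha> \<beta>)
  have sb: "summable b"
    using inverse_power_summable[of 2, where ?'a=real] unfolding b_def
    by (subst summable_Suc_iff) (simp add: field_simps)
  have ab: "\<And>k. 0 \<le> a k" "\<And>j. 0 \<le> b j" using Q by (auto simp: a_def b_def)
  have fb: "\<bar>f k j\<bar> \<le> a k * b j" for k j
  proof -
    have "\<bar>?e k j\<bar> \<le> 2 * (?s k)\<^sup>2 * Q * (1 / (real (Suc j))\<^sup>2)"
      using \<alpha> Q sep[of "Suc k" "Suc j"] by (intro pole_difference_bound) auto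
    then have "\<bar>sin (real (Suc j) * \<theta>)\<bar> * \<bar>?e k j\<bar> \<le> 1 * (2 * (?s k)\<^sup>2 * Q * (1 / (real (Suc j))\<^sup>2))"
      by (intro mult_mono) auto
    then have "\<beta> powr ?s k * (\<bar>sin (real (Suc j) * \<theta>)\<bar> * \<bar>?e k j\<bar>) \<le> \<beta> powr ?s k * (1 * (2 * (?s k)\<^sup>2 * Q * (1 / (real (Suc j))\<^sup>2)))"
      by (intro mult_left_mono) auto
    then show ?thesis by (simp add: f_def a_def b_def abs_mult mult_ac del: of_nat_Suc)
  qed
  have "(\<lambda>(k, j). a k * b j) summable_on (UNIV \<times> UNIV)"
  proof (rule summable_on_SigmaI)
    show "((\<lambda>j. case (k, j) of (k, j) \<Rightarrow> a k * b j) has_sum a k * suminf b) UNIV" for k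
    proof -
      have "norm (a k * b j) = a k * b j" for j
        unfolding real_norm_def by (rule abs_of_nonneg) (rule mult_nonneg_nonneg[OF ab])
      then have "summable (\<lambda>j. norm (a k * b j))" using summable_mult[OF sb, of "a k"] by (simp only:)
      then show ?thesis unfolding prod.case
        by (rule norm_summable_imp_has_sum) (rule sums_mult[OF summable_sums[OF sb]])
    qed
    show "(\<lambda>k. a k * suminf b) summable_on UNIV"
    proof (rule norm_summable_imp_summable_on)
      have "norm (a k * suminf b) = a k * suminf b" for k
        unfolding real_norm_def by (rule abs_of_nonneg) (rule mult_nonneg_nonneg[OF ab(1) suminf_nonneg[OF sb ab(2)]])
      then show "summable (\<lambda>k. norm (a k * suminf b))" using summable_mult2[OF sa, of "suminf b"] by (simp only:)
    qed
    show "0 \<le> (case (k, j) of (k, j) \<Rightarrow> a k * b j)" for k j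
      unfolding prod.case by (rule mult_nonneg_nonneg[OF ab])
  qed
  then have "(\<lambda>(k, j). f k j) summable_on (UNIV \<times> UNIV)"
    by (rule abs_summable_summable[OF Infinite_Sum.abs_summable_on_comparison_test'])
      (use fb in \<open>simp add: case_prod_beta\<close>)
  then obtain T where T: "((\<lambda>(k, j). f k j) has_sum T) (UNIV \<times> UNIV)" unfolding summable_on_def by blast
  have sfk: "summable (\<lambda>j. norm (f k j))" for k
    by (rule summable_comparison_test'[OF summable_mult[OF sb, of "a k"]]) (use fb in simp)
  have sfj: "summable (\<lambda>k. norm (f k j))" for j
    by (rule summable_comparison_test'[OF summable_mult2[OF sa, of "b j"]]) (use fb in simp)
  have fk: "(\<lambda>j. f k j) sums ((-1)^k * \<beta> powr ?s k * (sine_coeff \<theta> (?s k) - \<theta>))" for k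
    unfolding f_def using \<alpha> \<theta> by (intro sums_mult sine_expansion) auto
  have "((\<lambda>k. (-1)^k * \<beta> powr ?s k * (sine_coeff \<theta> (?s k) - \<theta>)) has_sum T) UNIV"
    by (rule has_sum_SigmaD[OF T]) (simp only: prod.case norm_summable_imp_has_sum[OF sfk fk])
  then have "(\<lambda>k. (-1)^k * \<beta> powr ?s k * (sine_coeff \<theta> (?s k) - \<theta>)) sums T" by (rule has_sum_imp_sums)
  moreover have "(\<lambda>k. (-1)^k * \<beta> powr ?s k * sine_coeff \<theta> (?s k) - (-1)^k * \<beta> powr ?s k * \<theta>) sums (Y - \<Phi> * \<theta>)"
    unfolding \<Phi>_def by (intro sums_diff Y sums_mult2 sums_alternating_powr \<alpha> \<beta>)
  then have "(\<lambda>k. (-1)^k * \<beta> powr ?s k * (sine_coeff \<theta> (?s k) - \<theta>)) sums (Y - \<Phi> * \<theta>)"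
    by (simp only: right_diff_distrib)
  ultimately have TY: "T = Y - \<Phi> * \<theta>" by (rule sums_unique2)
  define h where "h = (\<lambda>j. (-1)^j * sin (real (Suc j) * \<theta>) * (?J j - \<beta>^Suc j * moment_coeff \<alpha> \<beta> (Suc j) - \<Phi> * (2 / real (Suc j))))"
  have fj: "(\<lambda>k. f k j) sums h j" for j
  proof -
    have 1: "(\<lambda>k. (-1)^k * \<beta> powr ?s k * (1 / (?s k + real (Suc j)) + 1 / (real (Suc j) - ?s k))) sums
        (?J j - \<beta>^Suc j * moment_coeff \<alpha> \<beta> (Suc j))"
      using moment_expansion[OF \<alpha>(2) \<beta>, of "Suc j"] unfolding diff_Suc_1 by simp
    have 2: "(\<lambda>k. (-1)^k * \<beta> powr ?s k * (2 / real (Suc j))) sums (\<Phi> * (2 / real (Suc j)))"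
      unfolding \<Phi>_def by (intro sums_mult2 sums_alternating_powr \<alpha> \<beta>)
    have "(\<lambda>k. (-1)^j * sin (real (Suc j) * \<theta>) * ((-1)^k * \<beta> powr ?s k * (1 / (?s k + real (Suc j)) + 1 / (real (Suc j) - ?s k))
        - (-1)^k * \<beta> powr ?s k * (2 / real (Suc j)))) sums h j"
      unfolding h_def by (intro sums_mult sums_diff 1 2)
    moreover have "(-1)^j * sin (real (Suc j) * \<theta>) * ((-1)^k * \<beta> powr ?s k * (1 / (?s k + real (Suc j)) + 1 / (real (Suc j) - ?s k))
        - (-1)^k * \<beta> powr ?s k * (2 / real (Suc j))) = f k j" for k
      unfolding f_def right_diff_distrib[of "(-1)^k * \<beta> powr ?s k", symmetric] by (simp only: mult_ac)
    ultimately show ?thesis by (simp only:)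
  qed
  have "((\<lambda>(j, k). f k j) has_sum T) (UNIV \<times> UNIV)"
    using T by (subst has_sum_swap) (simp only: prod.case)
  then have "(h has_sum T) UNIV"
    by (rule has_sum_SigmaD) (simp only: prod.case norm_summable_imp_has_sum[OF sfj fj])
  then have "h sums T" by (rule has_sum_imp_sums)
  moreover have "h sums (IK - X - 2 * \<Phi> * (\<theta> / 2))"
  proof -
    have 1: "(\<lambda>m. (-1)^m * sin (real (Suc m) * \<theta>) * ?J m) sums IK"
      unfolding IK_def by (intro poisson_integral_sums continuous_on_folded_profile) (use \<alpha> \<beta> \<theta> in auto)
    have 2: "(\<lambda>m. 2 * \<Phi> * ((-1)^m * sin (real (Suc m) * \<theta>) * (1 / real (Suc m)))) sums (2 * \<Phi> * (\<theta> / 2))"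
      by (intro sums_mult sawtooth_sums \<theta>)
    have e: "h j = (-1)^j * sin (real (Suc j) * \<theta>) * ?J j - (-1)^j * sin (real (Suc j) * \<theta>) * (\<beta>^Suc j * moment_coeff \<alpha> \<beta> (Suc j))
        - 2 * \<Phi> * ((-1)^j * sin (real (Suc j) * \<theta>) * (1 / real (Suc j)))" for j
      unfolding h_def right_diff_distrib by simp
    show ?thesis by (rule sums_cong[THEN iffD2, OF e sums_diff[OF sums_diff[OF 1 X] 2]])
  qed
  ultimately have "T = IK - X - 2 * \<Phi> * (\<theta> / 2)" by (rule sums_unique2)
  then show ?thesis using TY by (simp add: IK_def)
qed

section \<open>The series expansion of the derivative\<close>

text \<open>The denominators in the expansion stay away from \<open>0\<close>, so that the powers of \<open>\<beta>\<close> alone ensure summability.\<close>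

lemma nat_sine_lower_bound:
  assumes "r \<in> \<rat>" "0 < r"
  obtains c where "0 < c" "\<And>n. r * real n \<notin> \<nat> \<Longrightarrow> c \<le> \<bar>sin (r * real n * pi)\<bar>"
proof -
  obtain p q :: nat where q: "q \<noteq> 0" and "\<bar>r\<bar> = real p / real q"
    using Rats_abs_nat_div_natE[OF assms(1)] by metis
  then have r: "r = real p / real q" using assms by simp
  obtain c where c: "0 < c" "\<And>x. real q * x \<in> \<int> \<Longrightarrow> x \<notin> \<int> \<Longrightarrow> c \<le> \<bar>sin (x * pi)\<bar>"
    using sin_rational_lower_bound[OF q] by blast
  show ?thesis
  proof (rule that[OF c(1)])
    fix n assume n: "r * real n \<notin> \<nat>"
    have "r * real n \<notin> \<int>"
      using n assms(2) by (simp add: Nats_altdef2)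
    moreover have "real q * (r * real n) = of_int (int p * int n)" using q by (simp add: r)
    then have "real q * (r * real n) \<in> \<int>" by (metis Ints_of_int)
    ultimately show "c \<le> \<bar>sin (r * real n * pi)\<bar>" by (rule c(2)[rotated])
  qed
qed

lemma infsum_split_positive:
  fixes u :: "nat \<Rightarrow> real"
  assumes "summable (\<lambda>j. norm (u (Suc j)))"
  shows "u summable_on {m. m \<ge> 1 \<and> P m}" "u summable_on {m. m \<ge> 1 \<and> \<not> P m}"
    and "(\<lambda>j. u (Suc j)) sums (infsum u {m. m \<ge> 1 \<and> \<not> P m} + infsum u {m. m \<ge> 1 \<and> P m})"
proof -
  have im: "Suc ` UNIV = {1..}" by (auto simp: image_iff) (metis Suc_le_D One_nat_def)
  have "(u \<circ> Suc) summable_on UNIV"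
    using norm_summable_imp_summable_on[OF assms] by (simp add: o_def)
  then have s: "u summable_on {1..}" unfolding im[symmetric] by (subst summable_on_reindex) auto
  show P: "u summable_on {m. m \<ge> 1 \<and> P m}" and N: "u summable_on {m. m \<ge> 1 \<and> \<not> P m}"
    by (rule summable_on_subset_banach[OF s]; auto)+
  have "infsum u {1..} = infsum u ({m. m \<ge> 1 \<and> \<not> P m} \<union> {m. m \<ge> 1 \<and> P m})"
    by (rule arg_cong[of _ _ "infsum u"]) auto
  also have "\<dots> = infsum u {m. m \<ge> 1 \<and> \<not> P m} + infsum u {m. m \<ge> 1 \<and> P m}"
    by (rule infsum_Un_disjoint[OF N P]) auto
  finally have e: "infsum u {1..} = infsum u {m. m \<ge> 1 \<and> \<not> P m} + infsum u {m. m \<ge> 1 \<and> P m}" .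
  have "(u has_sum infsum u {1..}) (Suc ` UNIV)" unfolding im using s by (rule has_sum_infsum)
  then have "((u \<circ> Suc) has_sum infsum u {1..}) UNIV" by (subst (asm) has_sum_reindex) auto
  then have "(u \<circ> Suc) sums infsum u {1..}" by (rule has_sum_imp_sums)
  then show "(\<lambda>j. u (Suc j)) sums (infsum u {m. m \<ge> 1 \<and> \<not> P m} + infsum u {m. m \<ge> 1 \<and> P m})"
    unfolding e o_def .
qed

lemma infsum_proportional:
  fixes f u :: "nat \<Rightarrow> real"
  assumes "u summable_on A" "\<And>m. m \<in> A \<Longrightarrow> f m = c * u m"
  shows "f summable_on A" "infsum f A = c * infsum u A"
proof -
  show "f summable_on A"
    using summable_on_cmult_right[OF assms(1), of c] summable_on_cong[of A f "\<lambda>m. c * u m"] assms(2) by blast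
  show "infsum f A = c * infsum u A"
    using infsum_cong[of A f "\<lambda>m. c * u m"] assms(2) infsum_cmult_right'[of c u A] by simp
qed

text \<open>The sums \<open>X\<close> and \<open>Y\<close> of \<open>poisson_integral_folded_profile\<close> each split into two parts, according to whether
the index is resonant; up to constants, these are the four series of the statement.\<close>

theorem proposition10:
  fixes \<alpha> \<rho> \<beta> :: real
  assumes "\<alpha> \<in> \<rat>" and "\<alpha> \<in> {0<..2}"
    and "\<rho> \<in> {1 - 1 / \<alpha>..1 / \<alpha>} \<inter> {0<..<1}"
    and "\<beta> \<in> {0<..<1}"
  shows
    "((\<lambda>m. (-1) ^ (m + 1) * \<beta> ^ (m - 1) * sin (\<rho> * real m * pi) / sin (real m * pi / \<alpha>))
        summable_on {m::nat. m \<ge> 1 \<and> real m / \<alpha> \<notin> \<nat>}) \<and>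
    ((\<lambda>k. (-1) ^ (k + 1) * \<beta> powr (\<alpha> * real k - 1) * sin (\<rho> * \<alpha> * real k * pi) / sin (\<alpha> * real k * pi))
        summable_on {k::nat. k \<ge> 1 \<and> \<alpha> * real k \<notin> \<nat>}) \<and>
    ((\<lambda>m. (-1) ^ nat \<lfloor>real m + real m / \<alpha>\<rfloor> * \<beta> ^ (m - 1) * sin (\<rho> * real m * pi))
        summable_on {m::nat. m \<ge> 1 \<and> real m / \<alpha> \<in> \<nat>}) \<and>
    ((\<lambda>k. (-1) ^ nat \<lfloor>real k * (\<alpha> + 1)\<rfloor> * \<beta> powr (\<alpha> * real k - 1) * cos (\<alpha> * \<rho> * real k * pi))
        summable_on {k::nat. k \<ge> 1 \<and> \<alpha> * real k \<in> \<nat>}) \<and>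
    (g \<alpha> \<rho> has_real_derivative
        (\<Sum>\<^sub>\<infinity>m\<in>{m::nat. m \<ge> 1 \<and> real m / \<alpha> \<notin> \<nat>}.
            (-1) ^ (m + 1) * \<beta> ^ (m - 1) * sin (\<rho> * real m * pi) / sin (real m * pi / \<alpha>))
      + \<alpha> * (\<Sum>\<^sub>\<infinity>k\<in>{k::nat. k \<ge> 1 \<and> \<alpha> * real k \<notin> \<nat>}.
            (-1) ^ (k + 1) * \<beta> powr (\<alpha> * real k - 1) * sin (\<rho> * \<alpha> * real k * pi) / sin (\<alpha> * real k * pi))
      - \<alpha> * ln \<beta> / pi * (\<Sum>\<^sub>\<infinity>m\<in>{m::nat. m \<ge> 1 \<and> real m / \<alpha> \<in> \<nat>}.
            (-1) ^ nat \<lfloor>real m + real m / \<alpha>\<rfloor> * \<beta> ^ (m - 1) * sin (\<rho> * real m * pi))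
      - \<alpha> * \<rho> * (\<Sum>\<^sub>\<infinity>k\<in>{k::nat. k \<ge> 1 \<and> \<alpha> * real k \<in> \<nat>}.
            (-1) ^ nat \<lfloor>real k * (\<alpha> + 1)\<rfloor> * \<beta> powr (\<alpha> * real k - 1) * cos (\<alpha> * \<rho> * real k * pi)))
      (at \<beta>)"
proof -
  have \<alpha>: "\<alpha> \<in> \<rat>" "0 < \<alpha>" and \<rho>: "0 < \<rho>" "\<rho> < 1" and \<beta>: "0 < \<beta>" "\<beta> < 1" using assms by auto
  define \<theta> where "\<theta> = pi * \<rho>"
  have \<theta>: "0 < \<theta>" "\<theta> < pi" using \<rho> by (auto simp: \<theta>_def)
  have ln\<beta>: "ln \<beta> \<noteq> 0" using \<beta> by simp
  define u where "u = (\<lambda>m. (-1)^(m-1) * sin (real m * \<theta>) * (\<beta>^m * moment_coeff \<alpha> \<beta> m))"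
  define v where "v = (\<lambda>k. (-1)^(k-1) * \<beta> powr (\<alpha> * real k) * sine_coeff \<theta> (\<alpha> * real k))"
  have su: "summable (\<lambda>j. norm (u (Suc j)))"
  proof -
    obtain c where c: "0 < c" "\<And>n. 1 / \<alpha> * real n \<notin> \<nat> \<Longrightarrow> c \<le> \<bar>sin (1 / \<alpha> * real n * pi)\<bar>"
      using nat_sine_lower_bound[of "1 / \<alpha>"] \<alpha> by auto
    have A: "\<bar>moment_coeff \<alpha> \<beta> n\<bar> \<le> pi / (\<alpha> * c) + \<bar>ln \<beta>\<bar>" for n
    proof (cases "real n / \<alpha> \<in> \<nat>")
      case True
      then show ?thesis using \<alpha> c(1) by (simp add: moment_coeff_def abs_mult)
    next
      case False
      then have "c \<le> \<bar>sin (real n * pi / \<alpha>)\<bar>" using c(2)[of n] by (simp add: mult.commute)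
      then have "pi / (\<alpha> * \<bar>sin (real n * pi / \<alpha>)\<bar>) \<le> pi / (\<alpha> * c)"
        using \<alpha> c(1) by (intro divide_left_mono mult_left_mono mult_pos_pos) auto
      then show ?thesis using False \<alpha> by (simp add: moment_coeff_def abs_mult)
    qed
    have "summable (\<lambda>j. \<beta> ^ Suc j * (pi / (\<alpha> * c) + \<bar>ln \<beta>\<bar>))"
      using \<beta> by (intro summable_mult2) (simp add: summable_geometric)
    then show ?thesis
    proof (rule summable_comparison_test')
      fix j
      have "norm (u (Suc j)) = \<bar>sin (real (Suc j) * \<theta>)\<bar> * (\<beta> ^ Suc j * \<bar>moment_coeff \<alpha> \<beta> (Suc j)\<bar>)"
        using \<beta> by (simp add: u_def abs_mult del: of_nat_Suc power_Suc)
      also have "\<dots> \<le> 1 * (\<beta> ^ Suc j * (pi / (\<alpha> * c) + \<bar>ln \<beta>\<bar>))"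
        using \<beta> by (intro mult_mono A) (auto simp del: power_Suc)
      finally show "norm (norm (u (Suc j))) \<le> \<beta> ^ Suc j * (pi / (\<alpha> * c) + \<bar>ln \<beta>\<bar>)" by simp
    qed
  qed
  have sv: "summable (\<lambda>k. norm (v (Suc k)))"
  proof -
    obtain c where c: "0 < c" "\<And>n. \<alpha> * real n \<notin> \<nat> \<Longrightarrow> c \<le> \<bar>sin (\<alpha> * real n * pi)\<bar>"
      using nat_sine_lower_bound[of \<alpha>] \<alpha> by auto
    have W: "\<bar>sine_coeff \<theta> (\<alpha> * real n)\<bar> \<le> \<theta> + pi / c" for n
    proof (cases "\<alpha> * real n \<in> \<nat>")
      case True
      have "\<theta> * \<bar>cos (\<alpha> * real n * \<theta>)\<bar> \<le> \<theta> + pi / c"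
        using \<theta> c(1) mult_left_le[OF abs_cos_le_one, of \<theta> "\<alpha> * real n * \<theta>"] by (simp add: add_increasing2)
      then show ?thesis using True \<theta> by (simp add: sine_coeff_def abs_mult)
    next
      case False
      have "pi * \<bar>sin (\<alpha> * real n * \<theta>)\<bar> / \<bar>sin (\<alpha> * real n * pi)\<bar> \<le> pi * 1 / c"
        using c(2)[OF False] c(1) by (intro frac_le mult_left_mono) auto
      then show ?thesis using False \<theta> by (simp add: sine_coeff_def abs_mult)
    qed
    have r: "\<beta> powr \<alpha> < 1" "0 < \<beta> powr \<alpha>" using \<alpha> \<beta> powr_less_mono2[of \<alpha> \<beta> 1] by auto
    then have "summable (\<lambda>k. (\<beta> powr \<alpha>) ^ Suc k * (\<theta> + pi / c))"
      by (intro summable_mult2) (simp add: summable_geometric)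
    then show ?thesis
    proof (rule summable_comparison_test')
      fix k
      have "norm (v (Suc k)) = \<beta> powr (\<alpha> * real (Suc k)) * \<bar>sine_coeff \<theta> (\<alpha> * real (Suc k))\<bar>"
        by (simp add: v_def abs_mult del: of_nat_Suc)
      also have "\<dots> \<le> \<beta> powr (\<alpha> * real (Suc k)) * (\<theta> + pi / c)" by (intro mult_left_mono W) auto
      also have "\<beta> powr (\<alpha> * real (Suc k)) = (\<beta> powr \<alpha>) ^ Suc k" by (rule powr_pow[OF \<beta>(1), symmetric])
      finally show "norm (norm (v (Suc k))) \<le> (\<beta> powr \<alpha>) ^ Suc k * (\<theta> + pi / c)" by simp
    qed
  qed
  let ?M = "{m::nat. m \<ge> 1 \<and> real m / \<alpha> \<notin> \<nat>}" and ?M' = "{m::nat. m \<ge> 1 \<and> real m / \<alpha> \<in> \<nat>}"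
  let ?K = "{k::nat. k \<ge> 1 \<and> \<alpha> * real k \<notin> \<nat>}" and ?K' = "{k::nat. k \<ge> 1 \<and> \<alpha> * real k \<in> \<nat>}"
  note U = infsum_split_positive[OF su, where P="\<lambda>m. real m / \<alpha> \<in> \<nat>"]
  note V = infsum_split_positive[OF sv, where P="\<lambda>k. \<alpha> * real k \<in> \<nat>"]
  have "integral {0..1} (\<lambda>y. poisson_kernel \<theta> y * folded_profile \<alpha> \<beta> y)
      = (infsum u ?M + infsum u ?M') + (infsum v ?K + infsum v ?K')"
    by (rule poisson_integral_folded_profile[OF \<alpha> \<beta> \<theta>])
      (use U(3) V(3) in \<open>simp_all only: u_def v_def diff_Suc_1\<close>)
  with g_has_derivative[OF \<alpha>(2) \<rho> \<beta>(1)]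
  have D: "(g \<alpha> \<rho> has_real_derivative \<alpha> / (pi * \<beta>) * ((infsum u ?M + infsum u ?M') + (infsum v ?K + infsum v ?K'))) (at \<beta>)"
    by (simp only: \<theta>_def)
  have pred: "(-1::real)^(m - Suc 0) = - ((-1)^m)" "\<beta>^(m - Suc 0) = \<beta>^m / \<beta>" if "m \<ge> 1" for m :: nat
    using that \<beta> by (cases m; simp)+
  have f1: "(-1) ^ (m + 1) * \<beta> ^ (m - 1) * sin (\<rho> * real m * pi) / sin (real m * pi / \<alpha>) = \<alpha> / (pi * \<beta>) * u m"
    if "m \<in> ?M" for m
    using that \<alpha> \<beta> by (simp add: u_def moment_coeff_def pred \<theta>_def mult_ac)
  have f3: "(-1) ^ nat \<lfloor>real m + real m / \<alpha>\<rfloor> * \<beta> ^ (m - 1) * sin (\<rho> * real m * pi) = - 1 / (\<beta> * ln \<beta>) * u m"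
    if m: "m \<in> ?M'" for m
  proof -
    obtain i where i: "real m / \<alpha> = real i" using m by (auto elim: Nats_cases)
    have "nat \<lfloor>real m + real m / \<alpha>\<rfloor> = m + i" "nat \<lfloor>real m / \<alpha>\<rfloor> = i" unfolding i by (simp_all flip: of_nat_add)
    then show ?thesis using m \<beta> ln\<beta> by (simp add: u_def moment_coeff_def pred \<theta>_def mult_ac power_add)
  qed
  have pw: "\<beta> powr (\<alpha> * real k - 1) = \<beta> powr (\<alpha> * real k) / \<beta>" for k using \<beta> by (simp add: powr_diff)
  have f2: "(-1) ^ (k + 1) * \<beta> powr (\<alpha> * real k - 1) * sin (\<rho> * \<alpha> * real k * pi) / sin (\<alpha> * real k * pi) = 1 / (pi * \<beta>) * v k"
    if "k \<in> ?K" for k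
    using that \<alpha> \<beta> by (simp add: v_def sine_coeff_def pred pw \<theta>_def mult_ac)
  have f4: "(-1) ^ nat \<lfloor>real k * (\<alpha> + 1)\<rfloor> * \<beta> powr (\<alpha> * real k - 1) * cos (\<alpha> * \<rho> * real k * pi) = - 1 / (pi * \<rho> * \<beta>) * v k"
    if k: "k \<in> ?K'" for k
  proof -
    obtain i where i: "\<alpha> * real k = real i" using k by (auto elim: Nats_cases)
    have "real k * (\<alpha> + 1) = real (k + i)" using i by (simp add: algebra_simps)
    then have "nat \<lfloor>real k * (\<alpha> + 1)\<rfloor> = k + i" by (simp only: floor_of_nat nat_int)
    moreover have "nat \<lfloor>\<alpha> * real k\<rfloor> = i" unfolding i by simp
    moreover have c: "\<alpha> * \<rho> * real k * pi = \<alpha> * real k * \<theta>" by (simp add: \<theta>_def)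
    ultimately show ?thesis unfolding c using k \<beta> \<rho> by (simp add: v_def sine_coeff_def pred pw power_add) (simp add: \<theta>_def)
  qed
  let ?f1 = "\<lambda>m::nat. (-1) ^ (m + 1) * \<beta> ^ (m - 1) * sin (\<rho> * real m * pi) / sin (real m * pi / \<alpha>)"
  let ?f2 = "\<lambda>k::nat. (-1) ^ (k + 1) * \<beta> powr (\<alpha> * real k - 1) * sin (\<rho> * \<alpha> * real k * pi) / sin (\<alpha> * real k * pi)"
  let ?f3 = "\<lambda>m::nat. (-1) ^ nat \<lfloor>real m + real m / \<alpha>\<rfloor> * \<beta> ^ (m - 1) * sin (\<rho> * real m * pi)"
  let ?f4 = "\<lambda>k::nat. (-1) ^ nat \<lfloor>real k * (\<alpha> + 1)\<rfloor> * \<beta> powr (\<alpha> * real k - 1) * cos (\<alpha> * \<rho> * real k * pi)"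
  have F1: "?f1 summable_on ?M" "infsum ?f1 ?M = \<alpha> / (pi * \<beta>) * infsum u ?M"
    by (rule infsum_proportional[OF U(2)], erule f1)+
  have F2: "?f2 summable_on ?K" "infsum ?f2 ?K = 1 / (pi * \<beta>) * infsum v ?K"
    by (rule infsum_proportional[OF V(2)], erule f2)+
  have F3: "?f3 summable_on ?M'" "infsum ?f3 ?M' = - 1 / (\<beta> * ln \<beta>) * infsum u ?M'"
    by (rule infsum_proportional[OF U(1)], erule f3)+
  have F4: "?f4 summable_on ?K'" "infsum ?f4 ?K' = - 1 / (pi * \<rho> * \<beta>) * infsum v ?K'"
    by (rule infsum_proportional[OF V(1)], erule f4)+
  have "\<alpha> / (pi * \<beta>) * ((infsum u ?M + infsum u ?M') + (infsum v ?K + infsum v ?K')) =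
      infsum ?f1 ?M + \<alpha> * infsum ?f2 ?K - \<alpha> * ln \<beta> / pi * infsum ?f3 ?M' - \<alpha> * \<rho> * infsum ?f4 ?K'"
    unfolding F1(2) F2(2) F3(2) F4(2) using \<beta> \<rho> ln\<beta> by (simp add: field_simps)
  from D[unfolded this] show ?thesis using F1(1) F2(1) F3(1) F4(1) by blast
qed

end
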